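(* Consider the regularized MPC setup described in the context. Assume that $D$ is positive definite, that $V_{\mathrm{reg}}(X,U,t)$ is real-valued and differentiable with respect to $(X,U)$, and that its gradient $$\psi_t(X,U):=\nabla_UV_{\mathrm{reg}}(X,U,t)+\bar B^\top\nabla_XV_{\mathrm{reg}}(X,U,t)$$ is Lipschitz with respect to $(X,U)$, uniformly in $t$. Suppose $A_{\mathrm{nom}}:=A-B\Pi_1D^{-1}C$ is Schur. Then, for any $\eta\in(\rho(A_{\mathrm{nom}}),1)$, there exist a positive definite matrix $P\in\mathbb{R}^{n\times n}$ and a positive scalar $\gamma$ such that $$ \begin{bmatrix} A^\top P A-\eta^2 P & A^\top P B\Pi_1\\ \Pi_1^\top B^\top P A & \Pi_1^\top B^\top P B\Pi_1\end{bmatrix} +\begin{bmatrix}\bar A&\bar B\\ 0&I_{Hm}\\ -C&-D\end{bmatrix}^\top \begin{bmatrix}I_{Hn+Hm}&0\\ 0&-\gamma I_{Hm}\end{bmatrix} \begin{bmatrix}\bar A&\bar B\\ 0&I_{Hm}\\ -C&-D\end{bmatrix}\prec 0 . $$ Furthermore, for any such $\gamma$, if the regularizer is scaled (i.e. multiplied by a positive constant) so that the Lipschitz constant of its gradient is $L=\gamma^{-1/2}$, then for any $x\in\mathbb{R}^n$ and $t\in\mathbb{N}$ the OCP with this scaled regularizer admits a unique optimal solution and no other stationary points (a stationary point being a solution $U$ of $Cx+DU+\psi_t(\bar Ax+\bar BU,U)=0$, with $\psi_t$ the gradient of the scaled regularizer).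
   Context: Plant: $x(t+1)=Ax(t)+Bu(t)$, $t\in\mathbb{N}=\{0,1,2,\dots\}$, with $A\in\mathbb{R}^{n\times n}$, $B\in\mathbb{R}^{n\times m}$. Let $H\ge 1$ be an integer (prediction horizon), and let $Q,Q_{\mathrm f}\in\mathbb{R}^{n\times n}$, $R\in\mathbb{R}^{m\times m}$ be symmetric cost matrices; write $\|v\|_Q^2=v^\top Qv$ (similarly for the others). For a state $x$ and time $t$, the optimal control problem (OCP) is: minimize over $U=[u_1;\dots;u_H]\in\mathbb{R}^{Hm}$ (each $u_h\in\mathbb{R}^m$) $$\tfrac12\sum_{h=1}^{H}(\|x_h\|_Q^2+\|u_h\|_R^2)+\tfrac12\|x_{H+1}\|_{Q_{\mathrm f}}^2+V_{\mathrm{reg}}(X,U,t),$$ where $x_1=x$, $x_{h+1}=Ax_h+Bu_h$ for $h=1,\dots,H$, and $X=[x_2;\dots;x_{H+1}]\in\mathbb{R}^{Hn}$. Define $\bar A:=[A;A^2;\dots;A^H]\in\mathbb{R}^{Hn\times n}$ (vertical stacking); $\bar B\in\mathbb{R}^{Hn\times Hm}$ the block lower triangular matrix whose $(i,j)$ block is $A^{i-j}B$ for $i\ge j$ and $0$ for $i<j$; $\bar Q:=\mathrm{diag}(Q,\dots,Q,Q_{\mathrm f})$ with $H-1$ copies of $Q$; $\bar R:=\mathrm{diag}(R,\dots,R)$ with $H$ copies; $C:=\bar B^\top\bar Q\bar A$; $D:=\bar R+\bar B^\top\bar Q\bar B$; $\Pi_1=[I_m\ 0]\in\mathbb{R}^{m\times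 Hm}$. Up to terms independent of $U$, the OCP is $\min_U\ U^\top Cx+\tfrac12U^\top DU+V_{\mathrm{reg}}(\bar Ax+\bar BU,U,t)$. $\rho(\cdot)$ is the spectral radius; a matrix is Schur if its spectral radius is less than 1. Positive definite matrices are symmetric; $\prec 0$ means negative definite. Lipschitz constants are with respect to Euclidean norms. *)

theory Defs
  imports "HOL-Analysis.Analysis"
begin

section \<open>Matrices\<close>

text \<open>On \<open>'a^'n^'n\<close> the class operation \<open>*\<close>, hence also \<open>^\<close>, is componentwise.\<close>

primrec matpow :: "real^'n^'n \<Rightarrow> nat \<Rightarrow> real^'n^'n" where
  "matpow A 0 = mat 1"
| "matpow A (Suc k) = A ** matpow A k"

definition spec :: "real^'n^'n \<Rightarrow> complex set" where
  "spec A = {l. \<exists>v. v \<noteq> 0 \<and> map_matrix complex_of_real A *v v = l *s v}"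

definition spec_radius :: "real^'n^'n \<Rightarrow> real" where
  "spec_radius A = Max (norm ` spec A)"

definition schur_stable :: "real^'n^'n \<Rightarrow> bool" where
  "schur_stable A \<longleftrightarrow> spec_radius A < 1"

definition sym_mat :: "real^'n^'n \<Rightarrow> bool" where
  "sym_mat M \<longleftrightarrow> transpose M = M"

definition pos_def :: "real^'n^'n \<Rightarrow> bool" where
  "pos_def M \<longleftrightarrow> sym_mat M \<and> (\<forall>v. v \<noteq> 0 \<longrightarrow> v \<bullet> (M *v v) > 0)"

definition neg_def :: "real^'n^'n \<Rightarrow> bool" where
  "neg_def M \<longleftrightarrow> sym_mat M \<and> (\<forall>v. v \<noteq> 0 \<longrightarrow> v \<bullet> (M *v v) < 0)"

definition sqnorm :: "real^'n^'n \<Rightarrow> real^'n \<Rightarrow> real" where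
  "sqnorm M v = v \<bullet> (M *v v)"

definition hcat :: "'a^'p^'r \<Rightarrow> 'a^'q^'r \<Rightarrow> 'a^('p + 'q)^'r" where
  "hcat M N = (\<chi> i j. case j of Inl k \<Rightarrow> M $ i $ k | Inr k \<Rightarrow> N $ i $ k)"

definition vcat :: "'a^'c^'p \<Rightarrow> 'a^'c^'q \<Rightarrow> 'a^'c^('p + 'q)" where
  "vcat M N = (\<chi> i. case i of Inl k \<Rightarrow> M $ k | Inr k \<Rightarrow> N $ k)"


section \<open>Horizon and stacked matrices\<close>

text \<open>
  The prediction horizon is \<open>H = CARD('h)\<close> for a finite linearly ordered type \<open>'h\<close>, whose elements
  are identified with \<open>1, \<dots>, H\<close> by \<open>idx\<close>. The stacked spaces of dimension \<open>Hn\<close> and \<open>Hm\<close> are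
  \<open>real^('h \<times> 'n)\<close> and \<open>real^('h \<times> 'm)\<close>; the entry at \<open>(h, i)\<close> is the \<open>i\<close>-th entry of the
  \<open>h\<close>-th block.
\<close>

definition idx :: "'h::{finite,linorder} \<Rightarrow> nat" where
  "idx h = card {..h}"

definition block :: "real^('h \<times> 'm) \<Rightarrow> 'h::finite \<Rightarrow> real^'m" where
  "block U h = (\<chi> i. U $ (h, i))"

definition stack_A :: "real^'n^'n \<Rightarrow> real^'n^('h::{finite,linorder} \<times> 'n)" where
  "stack_A A = (\<chi> r j. case r of (h, i) \<Rightarrow> matpow A (idx h) $ i $ j)"

definition stack_B ::
  "real^'n^'n \<Rightarrow> real^'m^'n \<Rightarrow> real^('h \<times> 'm)^('h::{finite,linorder} \<times> 'n)" where
  "stack_B A B = (\<chi> r c. case (r, c) of ((h, i), (k, j)) \<Rightarrow>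
     if k \<le> h then (matpow A (idx h - idx k) ** B) $ i $ j else 0)"

definition stack_Q ::
  "real^'n^'n \<Rightarrow> real^'n^'n \<Rightarrow> real^('h \<times> 'n)^('h::{finite,linorder} \<times> 'n)" where
  "stack_Q Q Qf = (\<chi> r c. case (r, c) of ((h, i), (k, j)) \<Rightarrow>
     if h = k then (if idx h = CARD('h) then Qf else Q) $ i $ j else 0)"

definition stack_R :: "real^'m^'m \<Rightarrow> real^('h \<times> 'm)^('h::{finite,linorder} \<times> 'm)" where
  "stack_R R = (\<chi> r c. case (r, c) of ((h, i), (k, j)) \<Rightarrow> if h = k then R $ i $ j else 0)"

definition C_mat ::
  "real^'n^'n \<Rightarrow> real^'m^'n \<Rightarrow> real^'n^'n \<Rightarrow> real^'n^'n
    \<Rightarrow> real^'n^('h::{finite,linorder} \<times> 'm)" where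
  "C_mat A B Q Qf = transpose (stack_B A B) ** stack_Q Q Qf ** stack_A A"

definition D_mat ::
  "real^'n^'n \<Rightarrow> real^'m^'n \<Rightarrow> real^'n^'n \<Rightarrow> real^'n^'n \<Rightarrow> real^'m^'m
    \<Rightarrow> real^('h \<times> 'm)^('h::{finite,linorder} \<times> 'm)" where
  "D_mat A B Q Qf R = stack_R R + transpose (stack_B A B) ** stack_Q Q Qf ** stack_B A B"

definition Pi1 :: "real^('h::{finite,linorder} \<times> 'm)^'m" where
  "Pi1 = (\<chi> i c. case c of (h, j) \<Rightarrow> if idx h = 1 \<and> i = j then 1 else 0)"


section \<open>Optimal control problem\<close>

text \<open>
  \<open>state A B x U k\<close> is the predicted state \<open>x\<^sub>k\<^sub>+\<^sub>1\<close>, so \<open>state A B x U (idx h - 1)\<close> is \<open>x\<^sub>h\<close>. Only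
  the values for \<open>k \<le> CARD('h)\<close> are meaningful, since \<open>idx\<close> is a bijection onto
  \<open>{1..CARD('h)}\<close>.
\<close>

primrec state ::
  "real^'n^'n \<Rightarrow> real^'m^'n \<Rightarrow> real^'n \<Rightarrow> real^('h::{finite,linorder} \<times> 'm) \<Rightarrow> nat \<Rightarrow> real^'n"
where
  "state A B x U 0 = x"
| "state A B x U (Suc k) = A *v state A B x U k + B *v block U (inv idx (Suc k))"

definition state_stack ::
  "real^'n^'n \<Rightarrow> real^'m^'n \<Rightarrow> real^'n \<Rightarrow> real^('h::{finite,linorder} \<times> 'm) \<Rightarrow> real^('h \<times> 'n)"
where
  "state_stack A B x U = (\<chi> r. case r of (h, i) \<Rightarrow> state A B x U (idx h) $ i)"

definition ocp_cost ::
  "real^'n^'n \<Rightarrow> real^'m^'n \<Rightarrow> real^'n^'n \<Rightarrow> real^'n^'n \<Rightarrow> real^'m^'m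
    \<Rightarrow> (real^('h \<times> 'n) \<Rightarrow> real^('h \<times> 'm) \<Rightarrow> nat \<Rightarrow> real)
    \<Rightarrow> real^'n \<Rightarrow> nat \<Rightarrow> real^('h::{finite,linorder} \<times> 'm) \<Rightarrow> real"
where
  "ocp_cost A B Q Qf R V x t U =
     1/2 * (\<Sum>h\<in>UNIV. sqnorm Q (state A B x U (idx h - 1)) + sqnorm R (block U h))
     + 1/2 * sqnorm Qf (state A B x U CARD('h))
     + V (state_stack A B x U) U t"

definition ocp_solution ::
  "real^'n^'n \<Rightarrow> real^'m^'n \<Rightarrow> real^'n^'n \<Rightarrow> real^'n^'n \<Rightarrow> real^'m^'m
    \<Rightarrow> (real^('h \<times> 'n) \<Rightarrow> real^('h \<times> 'm) \<Rightarrow> nat \<Rightarrow> real)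
    \<Rightarrow> real^'n \<Rightarrow> nat \<Rightarrow> real^('h::{finite,linorder} \<times> 'm) \<Rightarrow> bool"
where
  "ocp_solution A B Q Qf R V x t U \<longleftrightarrow> is_arg_min (ocp_cost A B Q Qf R V x t) (\<lambda>_. True) U"

definition grad :: "('a::real_inner \<Rightarrow> real) \<Rightarrow> 'a \<Rightarrow> 'a" where
  "grad f z = (THE g. GDERIV f z :> g)"

definition psi ::
  "real^'n^'n \<Rightarrow> real^'m^'n
    \<Rightarrow> (real^('h \<times> 'n) \<Rightarrow> real^('h \<times> 'm) \<Rightarrow> nat \<Rightarrow> real)
    \<Rightarrow> nat \<Rightarrow> real^('h \<times> 'n) \<Rightarrow> real^('h \<times> 'm) \<Rightarrow> real^('h::{finite,linorder} \<times> 'm)"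
where
  "psi A B V t X U =
     grad (\<lambda>U'. V X U' t) U + transpose (stack_B A B) *v grad (\<lambda>X'. V X' U t) X"

definition ocp_stationary ::
  "real^'n^'n \<Rightarrow> real^'m^'n \<Rightarrow> real^'n^'n \<Rightarrow> real^'n^'n \<Rightarrow> real^'m^'m
    \<Rightarrow> (real^('h \<times> 'n) \<Rightarrow> real^('h \<times> 'm) \<Rightarrow> nat \<Rightarrow> real)
    \<Rightarrow> real^'n \<Rightarrow> nat \<Rightarrow> real^('h::{finite,linorder} \<times> 'm) \<Rightarrow> bool"
where
  "ocp_stationary A B Q Qf R V x t U \<longleftrightarrow>
     C_mat A B Q Qf *v x + D_mat A B Q Qf R *v U
       + psi A B V t (stack_A A *v x + stack_B A B *v U) U = 0"

text \<open>
  Products carry the Euclidean norm, so this is Lipschitz continuity in \<open>(X, U)\<close> with respect to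
  Euclidean norms. \<open>L\<close> need not be the smallest constant.
\<close>

definition psi_lipschitz ::
  "real \<Rightarrow> real^'n^'n \<Rightarrow> real^'m^'n
    \<Rightarrow> (real^('h::{finite,linorder} \<times> 'n) \<Rightarrow> real^('h \<times> 'm) \<Rightarrow> nat \<Rightarrow> real) \<Rightarrow> bool"
where
  "psi_lipschitz L A B V \<longleftrightarrow> (\<forall>t. L-lipschitz_on UNIV (\<lambda>(X, U). psi A B V t X U))"


section \<open>Matrix inequality\<close>

definition lmi_matrix ::
  "real^'n^'n \<Rightarrow> real^'m^'n \<Rightarrow> real^'n^('h::{finite,linorder} \<times> 'n) \<Rightarrow> real^('h \<times> 'm)^('h \<times> 'n)
    \<Rightarrow> real^'n^('h \<times> 'm) \<Rightarrow> real^('h \<times> 'm)^('h \<times> 'm)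
    \<Rightarrow> real \<Rightarrow> real^'n^'n \<Rightarrow> real \<Rightarrow> real^('n + 'h \<times> 'm)^('n + 'h \<times> 'm)"
where
  "lmi_matrix A B Abar Bbar C D \<eta> P \<gamma> =
    (let E = (Pi1 :: real^('h \<times> 'm)^'m);
         S = vcat (vcat (hcat Abar Bbar) (hcat 0 (mat 1))) (hcat (- C) (- D));
         M = vcat (hcat (mat 1) 0) (hcat 0 (- \<gamma> *\<^sub>R mat 1))
     in vcat
          (hcat (transpose A ** P ** A - \<eta>\<^sup>2 *\<^sub>R P) (transpose A ** P ** B ** E))
          (hcat (transpose E ** transpose B ** P ** A)
                (transpose E ** transpose B ** P ** B ** E))
        + transpose S ** M ** S)"

end

theory Submission
  imports Defs "HOL-Computational_Algebra.Fundamental_Theorem_Algebra"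
begin

text \<open>
  At the stacked vector of \<open>x\<close> and \<open>U\<close>, the matrix in the inequality has the quadratic form
  \<open>\<parallel>x'\<parallel>\<^sub>P\<^sup>2 - \<eta>\<^sup>2 \<parallel>x\<parallel>\<^sub>P\<^sup>2 + \<parallel>\<^bold>A x + \<^bold>B U\<parallel>\<^sup>2 + \<parallel>U\<parallel>\<^sup>2 - \<gamma> \<parallel>C x + D U\<parallel>\<^sup>2\<close>, where
  \<open>x' = A x + B \<Pi>\<^sub>1 U\<close> is the plant successor, and \<open>\<^bold>A\<close>, \<open>\<^bold>B\<close> are the stacked prediction
  matrices (\<open>lmi_quadratic_form\<close>). Everything is read off from this form.

  Feasibility. The last term vanishes exactly for \<open>U = - D\<^sup>-\<^sup>1 C x\<close>, the unregularized control
  law, for which \<open>x' = A_nom x\<close>. Since \<open>\<rho>(A_nom) < \<eta>\<close>, a Lyapunov matrix makes the first two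
  terms at most \<open>- \<eta>\<^sup>2/2 \<parallel>x\<parallel>\<^sup>2\<close> there, and scaling it lets them dominate the next two, which are
  bounded by a multiple of \<open>\<parallel>x\<parallel>\<^sup>2\<close>. A form that is negative definite on the kernel of a matrix becomes negative
  definite everywhere after subtracting a large multiple of the squared norm of the image (\<open>finsler\<close>);
  this gives \<open>\<gamma>\<close>. The Lyapunov matrix needs the powers of \<open>A_nom / \<eta>\<close> to decay. This is proved
  without normal forms: a polynomial of least degree annihilating the complexified matrix has exactly
  the eigenvalues as its roots, and its linear factors are peeled off one at a time, each
  costing only a scalar recursion with ratio less than one.

  Uniqueness. At \<open>x = 0\<close> the inequality gives \<open>\<gamma>\<^sup>-\<^sup>1\<^sup>/\<^sup>2 \<parallel>(\<^bold>B U, U)\<parallel> < \<parallel>D U\<parallel>\<close> for \<open>U \<noteq> 0\<close>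
  (\<open>lmi_small_gain\<close>), so the regularizer gradient along the affine map
  \<open>U \<mapsto> (\<^bold>A x + \<^bold>B U, U)\<close> varies strictly less than \<open>D U\<close>. By compactness the ratio is at most some
  \<open>q < 1\<close>, so, in the variable \<open>W = D U\<close>, stationarity is a fixed-point equation for a contraction,
  and there is a unique stationary point \<open>U\<^sub>s\<close>.

  Optimality. Neither convexity nor coercivity of the cost is evident, so existence of a minimizer does
  not come from them. But the gradient at \<open>U \<noteq> U\<^sub>s\<close> has positive inner product with
  \<open>D (U - U\<^sub>s)\<close>; thus the step \<open>- D (U - U\<^sub>s)\<close> decreases the cost, and it also decreases the
  distance to \<open>U\<^sub>s\<close> because \<open>D\<close> is positive definite. So the minimum over any closed
  ball around \<open>U\<^sub>s\<close> is attained at the center, which makes \<open>U\<^sub>s\<close> a global minimizer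
  (\<open>minimum_of_descent_field\<close>).
\<close>


section \<open>Polynomials in a matrix\<close>

lemma matrix_mult_zero: "(M :: 'a::semiring_1^'n^'m) ** (0 :: 'a^'p^'n) = 0"
  by (simp add: matrix_matrix_mult_def vec_eq_iff)

lemma mat_mult_nth: "((mat c :: 'a::semiring_1^'n^'n) ** W) $ i $ j = c * W $ i $ j"
  unfolding matrix_matrix_mult_def mat_def
  by (simp add: if_distrib [where f = "\<lambda>a. a * _"] cong: if_cong)

lemma mult_mat_nth: "(W ** (mat c :: 'a::semiring_1^'n^'n)) $ i $ j = W $ i $ j * c"
  unfolding matrix_matrix_mult_def mat_def
  by (simp add: if_distrib [where f = "\<lambda>a. _ * a"] cong: if_cong)

lemma mat_mult_vector: "(mat c :: 'a::semiring_1^'n^'n) *v v = c *s v"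
  unfolding matrix_vector_mult_def mat_def
  by (simp add: vec_eq_iff if_distrib [where f = "\<lambda>a. a * _"] cong: if_cong)

lemma mult_mat_commute: "M ** mat c = (mat c :: complex^'n^'n) ** M"
  by (simp add: vec_eq_iff mat_mult_nth mult_mat_nth mult.commute)

lemma matrix_diff_rdistrib: "(A - B) ** (C :: complex^'n^'n) = A ** C - B ** C"
  by (simp add: matrix_matrix_mult_def vec_eq_iff left_diff_distrib sum_subtractf)

text \<open>
  The value \<open>p(M)\<close>, by Horner's scheme. The product of matrices is not the class operation \<open>*\<close>, so
  \<open>poly\<close> does not apply, and a complex scalar has to enter as the scalar matrix \<open>mat a\<close>.
\<close>

definition mpoly :: "complex^'n^'n \<Rightarrow> complex poly \<Rightarrow> complex^'n^'n" where
  "mpoly M p = fold_coeffs (\<lambda>a W. mat a + M ** W) p 0"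

lemma mpoly_0 [simp]: "mpoly M 0 = 0"
  by (simp add: mpoly_def)

lemma mpoly_pCons: "mpoly M (pCons a p) = mat a + M ** mpoly M p"
  by (cases "p = 0 \<and> a = 0") (auto simp: mpoly_def matrix_mult_zero fold_coeffs_pCons_not_0_0_eq)

lemma mpoly_add: "mpoly M (p + q) = mpoly M p + mpoly M q"
proof (induction p arbitrary: q)
  case (pCons a p)
  obtain b q' where "q = pCons b q'" by (cases q)
  moreover have "mat (a + b) = mat a + (mat b :: complex^'n^'n)"
    by (simp add: mat_def vec_eq_iff)
  ultimately show ?case
    by (simp add: mpoly_pCons pCons.IH matrix_add_ldistrib)
qed simp

lemma mpoly_smult: "mpoly M (smult c p) = mat c ** mpoly M p"
proof (induction p)
  case 0
  show ?case by (simp add: matrix_mult_zero)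
next
  case (pCons a p)
  have "mat (c * a) = mat c ** (mat a :: complex^'n^'n)"
    by (simp add: vec_eq_iff mat_mult_nth) (simp add: mat_def)
  moreover have "M ** (mat c ** mpoly M p) = mat c ** (M ** mpoly M p)"
    by (simp only: matrix_mul_assoc mult_mat_commute [of M c])
  ultimately show ?case
    by (simp add: mpoly_pCons pCons.IH matrix_add_ldistrib)
qed

lemma mpoly_diff: "mpoly M (p - q) = mpoly M p - mpoly M q"
  using mpoly_add [of M "p - q" q] by simp

lemma mpoly_linear_factor: "mpoly M ([:- l, 1:] * q) = (M - mat l) ** mpoly M q"
proof -
  have "mpoly M ([:- l, 1:] * q) = mpoly M (pCons 0 q - smult l q)"
    by simp
  also have "\<dots> = (M - mat l) ** mpoly M q"
    unfolding mpoly_diff mpoly_pCons mpoly_smult matrix_diff_rdistrib by simp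
  finally show ?thesis .
qed

lemma mpoly_eigenvector:
  assumes "M *v v = l *s v"
  shows "mpoly M p *v v = poly p l *s v"
proof (induction p)
  case (pCons a p)
  have "mpoly M (pCons a p) *v v = a *s v + M *v (mpoly M p *v v)"
    by (simp only: mpoly_pCons matrix_vector_mult_add_rdistrib mat_mult_vector matrix_vector_mul_assoc)
  also have "\<dots> = a *s v + poly p l *s (l *s v)"
    by (simp only: pCons.IH vector_scalar_commute assms)
  finally show ?case
    by (simp add: vector_sadd_rdistrib vector_smult_assoc mult.commute)
qed simp

text \<open>
  Otherwise the values up to any index would be independent, beyond the dimension.
\<close>

lemma exists_in_span_of_predecessors:
  fixes f :: "nat \<Rightarrow> 'a::euclidean_space"
  shows "\<exists>k. f k \<in> span (f ` {..<k})"
proof (rule ccontr)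
  assume no: "\<nexists>k. f k \<in> span (f ` {..<k})"
  have ind: "independent (f ` {..<k}) \<and> card (f ` {..<k}) = k" for k
  proof (induction k)
    case (Suc k)
    have notin: "f k \<notin> span (f ` {..<k})"
      using no by simp
    then have fresh: "f k \<notin> f ` {..<k}"
      by (rule contrapos_nn) (rule span_base)
    have "independent (insert (f k) (f ` {..<k}))"
      using Suc notin by (intro independent_insertI) auto
    then show ?case
      unfolding lessThan_Suc image_insert using Suc fresh by simp
  qed (simp add: independent_empty)
  show False
    using independent_bound [OF conjunct1 [OF ind [of "Suc DIM('a)"]]]
      conjunct2 [OF ind [of "Suc DIM('a)"]] by linarith
qed

text \<open>
  The powers of \<open>M\<close> live in a finite-dimensional space, so some power is a combination of
  earlier ones. Real coefficients suffice, hence the dimension argument is over the reals.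
\<close>

lemma exists_annihilating_poly: "\<exists>p. p \<noteq> 0 \<and> mpoly M p = 0"
proof -
  let ?f = "\<lambda>k. mpoly M (monom 1 k)"
  obtain k where k: "?f k \<in> span (?f ` {..<k})"
    using exists_in_span_of_predecessors [of ?f] by (elim exE)
  let ?S = "{mpoly M q | q. \<forall>i\<ge>k. coeff q i = 0}"
  have scale: "r *\<^sub>R mpoly M q = mpoly M (smult (complex_of_real r) q)" for r q
    unfolding mpoly_smult vec_eq_iff
    by (auto simp add: mat_mult_nth scaleR_conv_of_real[where 'a=complex])
  have subspace: "subspace ?S"
    unfolding subspace_def
  proof safe
    show "\<exists>q. 0 = mpoly M q \<and> (\<forall>i\<ge>k. coeff q i = 0)"
      by (rule exI [of _ 0]) simp
  next
    fix p q :: "complex poly" assume "\<forall>i\<ge>k. coeff p i = 0" "\<forall>i\<ge>k. coeff q i = 0"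
    then show "\<exists>r. mpoly M p + mpoly M q = mpoly M r \<and> (\<forall>i\<ge>k. coeff r i = 0)"
      by (intro exI [of _ "p + q"]) (simp add: mpoly_add)
  next
    fix c and q :: "complex poly" assume "\<forall>i\<ge>k. coeff q i = 0"
    then show "\<exists>r. c *\<^sub>R mpoly M q = mpoly M r \<and> (\<forall>i\<ge>k. coeff r i = 0)"
      by (intro exI [of _ "smult (complex_of_real c) q"]) (simp add: scale)
  qed
  have "?f ` {..<k} \<subseteq> ?S"
  proof
    fix W assume "W \<in> ?f ` {..<k}"
    then obtain i where "W = ?f i" "i < k"
      by blast
    then show "W \<in> ?S"
      by (intro CollectI exI [of _ "monom 1 i"]) auto
  qed
  then have "?f k \<in> ?S"
    using subspace k by (rule subsetD [OF span_minimal])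
  then obtain q where q: "?f k = mpoly M q" "\<forall>i\<ge>k. coeff q i = 0"
    by blast
  have "coeff (monom 1 k - q) k \<noteq> 0"
    using q by simp
  then have "monom 1 k - q \<noteq> 0"
    by auto
  moreover have "mpoly M (monom 1 k - q) = 0"
    using q by (simp add: mpoly_diff)
  ultimately show ?thesis
    by blast
qed

text \<open>
  Minimality of the degree is what makes every root an eigenvalue: if \<open>p = (X - l) q\<close>, then
  \<open>q(M) \<noteq> 0\<close>, and any nonzero value of \<open>q(M)\<close> is an eigenvector for \<open>l\<close>.
\<close>

lemma exists_annihilating_poly_roots_eigenvalues:
  fixes M :: "complex^'n^'n"
  obtains p where "p \<noteq> 0" "mpoly M p = 0"
    "\<And>l. poly p l = 0 \<longleftrightarrow> (\<exists>v. v \<noteq> 0 \<and> M *v v = l *s v)"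
proof -
  obtain p where p: "p \<noteq> 0" "mpoly M p = 0"
    and least: "\<And>q. q \<noteq> 0 \<Longrightarrow> mpoly M q = 0 \<Longrightarrow> degree p \<le> degree q"
    using ex_has_least_nat [of "\<lambda>p. p \<noteq> 0 \<and> mpoly M p = 0" _ degree]
      exists_annihilating_poly [of M] by metis
  have "\<exists>v. v \<noteq> 0 \<and> M *v v = l *s v" if root: "poly p l = 0" for l
  proof -
    obtain q where q: "p = [:- l, 1:] * q"
      using root unfolding poly_eq_0_iff_dvd by (rule dvdE)
    with p have "q \<noteq> 0"
      by auto
    then have "degree p = Suc (degree q)"
      unfolding q by (subst degree_mult_eq) auto
    with least [OF \<open>q \<noteq> 0\<close>] have "mpoly M q \<noteq> 0"
      by auto
    then obtain w where w: "mpoly M q *v w \<noteq> 0"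
      by (metis matrix_eq matrix_vector_mult_0)
    have "(M - mat l) *v (mpoly M q *v w) = 0"
      using p q mpoly_linear_factor [of M l q] by (simp add: matrix_vector_mul_assoc)
    then have "M *v (mpoly M q *v w) = l *s (mpoly M q *v w)"
      by (simp add: matrix_vector_mult_diff_rdistrib mat_mult_vector)
    with w show ?thesis
      by blast
  qed
  moreover have "poly p l = 0" if "v \<noteq> 0" "M *v v = l *s v" for v l
    using mpoly_eigenvector [OF that(2), of p] p that(1) by simp
  ultimately show thesis
    using p that by blast
qed


section \<open>Decay of matrix powers\<close>

lemma summable_contractive_recursion:
  fixes a b :: "nat \<Rightarrow> real"
  assumes nonneg: "\<And>j. 0 \<le> a j" "\<And>j. 0 \<le> b j" and q: "0 \<le> q" "q < 1"
    and rec: "\<And>j. a (Suc j) \<le> q * a j + b j" and b: "summable b"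
  shows "summable a"
proof (rule bounded_imp_summable [OF nonneg(1)])
  fix n
  have "(\<Sum>j\<le>n. a j) \<le> a 0 + (\<Sum>j\<le>n. a (Suc j))"
    using sum.atMost_Suc_shift [of a n] nonneg(1) [of "Suc n"] by simp
  also have "(\<Sum>j\<le>n. a (Suc j)) \<le> q * (\<Sum>j\<le>n. a j) + (\<Sum>j\<le>n. b j)"
    using sum_mono [of "{..n}" "\<lambda>j. a (Suc j)" "\<lambda>j. q * a j + b j"] rec
    by (simp add: sum.distrib sum_distrib_left)
  also have "(\<Sum>j\<le>n. b j) \<le> suminf b"
    using b nonneg(2) by (intro sum_le_suminf) auto
  finally have "(1 - q) * (\<Sum>j\<le>n. a j) \<le> a 0 + suminf b"
    by (simp add: algebra_simps)
  with q show "(\<Sum>j\<le>n. a j) \<le> (a 0 + suminf b) / (1 - q)"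
    by (simp add: field_simps)
qed

text \<open>
  Summability instead of convergence to zero, because it passes through the recursion of
  \<open>summable_contractive_recursion\<close> with a one-line estimate.
\<close>

definition decays :: "complex^'n^'n \<Rightarrow> real \<Rightarrow> complex^'n \<Rightarrow> bool" where
  "decays M r v \<longleftrightarrow> summable (\<lambda>j. norm (((*v) M ^^ j) v) / r ^ j)"

lemma norm_smult_complex: "norm (c *s (v :: complex^'n)) = norm c * norm v"
  unfolding norm_vec_def
  by (simp add: norm_mult L2_set_right_distrib)

lemma funpow_matrix_affine:
  fixes M :: "complex^'n^'n"
  shows "((*v) M ^^ j) (l *s v + w) = l *s ((*v) M ^^ j) v + ((*v) M ^^ j) w"
  by (induction j) (auto simp: matrix_vector_right_distrib vector_scalar_commute)

lemma funpow_matrix_0: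
  fixes M :: "complex^'n^'n"
  shows "((*v) M ^^ j) 0 = 0"
  by (induction j) auto

text \<open>
  With \<open>w = (M - l) v\<close> the orbit of \<open>v\<close> obeys \<open>M\<^sup>j\<^sup>+\<^sup>1 v = l M\<^sup>j v + M\<^sup>j w\<close>, a
  scalar recursion with ratio \<open>\<bar>l\<bar> / r < 1\<close> after rescaling by \<open>r\<^sup>j\<close>.
\<close>

lemma decays_linear_factor:
  assumes w: "decays M r ((M - mat l) *v v)" and l: "norm l < r"
  shows "decays M r v"
proof -
  let ?w = "(M - mat l) *v v" and ?i = "\<lambda>v j. ((*v) M ^^ j) v"
  have r: "r > 0"
    using l norm_ge_zero [of l] by linarith
  have "M *v v = l *s v + ?w"
    by (simp add: matrix_vector_mult_diff_rdistrib mat_mult_vector)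
  then have "norm (?i v (Suc j)) \<le> norm l * norm (?i v j) + norm (?i ?w j)" for j
    unfolding funpow_Suc_right o_def
    by (simp only: funpow_matrix_affine flip: norm_smult_complex) (rule norm_triangle_ineq)
  then have rec: "norm (?i v (Suc j)) / r ^ Suc j
      \<le> norm l / r * (norm (?i v j) / r ^ j) + norm (?i ?w j) / r ^ j / r" for j
    using r by (simp add: field_simps del: funpow.simps)
  have "summable (\<lambda>j. norm (?i ?w j) / r ^ j / r)"
    using w unfolding decays_def by (rule summable_divide)
  then show ?thesis
    unfolding decays_def
    using r l rec
    by (intro summable_contractive_recursion [where q = "norm l / r"
          and a = "\<lambda>j. norm (?i v j) / r ^ j" and b = "\<lambda>j. norm (?i ?w j) / r ^ j / r"])
       (simp_all only: zero_le_divide_iff zero_le_power norm_ge_zero less_imp_le divide_less_eq_1_pos simp_thms)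
qed

text \<open>
  Induction on the degree, removing one linear factor at a time; what remains in the end is a
  nonzero scalar.
\<close>

lemma decays_of_annihilating_poly:
  assumes "p \<noteq> 0" and "\<And>l. poly p l = 0 \<Longrightarrow> norm l < r" and "decays M r (mpoly M p *v v)"
  shows "decays M r v"
  using assms
proof (induction "degree p" arbitrary: p rule: less_induct)
  case less
  show ?case
  proof (cases "degree p = 0")
    case True
    then obtain c where p: "p = [:c:]"
      by (auto elim: degree_eq_zeroE)
    with less.prems have "c \<noteq> 0"
      by simp
    have "mpoly M p *v v = c *s v"
      by (simp add: p mpoly_pCons matrix_mult_zero mat_mult_vector)
    moreover have "((*v) M ^^ j) (c *s v) = c *s (((*v) M ^^ j) v)" for j
      using funpow_matrix_affine [of j M c v 0] by (simp add: funpow_matrix_0)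
    ultimately have "summable (\<lambda>j. norm c * (norm (((*v) M ^^ j) v) / r ^ j))"
      using less.prems(3) by (simp add: decays_def norm_smult_complex)
    then show ?thesis
      using \<open>c \<noteq> 0\<close> unfolding decays_def summable_cmult_iff by simp
  next
    case False
    then have "\<not> constant (poly p)"
      by (simp add: constant_degree)
    then obtain l where l: "poly p l = 0"
      using fundamental_theorem_of_algebra by blast
    then obtain q where q: "p = [:- l, 1:] * q"
      unfolding poly_eq_0_iff_dvd by (rule dvdE)
    with less.prems have "q \<noteq> 0"
      by auto
    then have deg: "degree q < degree p"
      unfolding q by (subst degree_mult_eq) auto
    have "mpoly M p *v v = (M - mat l) *v (mpoly M q *v v)"
      unfolding q mpoly_linear_factor matrix_vector_mul_assoc ..
    then have "decays M r (mpoly M q *v v)"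
      using less.prems(2,3) l by (simp add: decays_linear_factor)
    then show ?thesis
      using less.hyps [OF deg \<open>q \<noteq> 0\<close>] less.prems(2) by (simp add: q)
  qed
qed

abbreviation cvec :: "real^'n \<Rightarrow> complex^'n" where
  "cvec x \<equiv> (\<chi> i. complex_of_real (x $ i))"

abbreviation cmat :: "real^'n^'n \<Rightarrow> complex^'n^'n" where
  "cmat A \<equiv> map_matrix complex_of_real A"

lemma cmat_mult_cvec: "cmat A *v cvec x = cvec (A *v x)"
  by (simp add: vec_eq_iff matrix_vector_mult_def map_matrix_def)

lemma norm_cvec: "norm (cvec x) = norm x"
  by (simp add: norm_vec_def)

lemma funpow_cmat: "((*v) (cmat A) ^^ j) (cvec x) = cvec (matpow A j *v x)"
  by (induction j) (simp_all add: cmat_mult_cvec matrix_vector_mul_assoc)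

text \<open>
  The spectrum is the root set of \<open>p\<close>, hence finite, so the maximum defining the spectral radius
  bounds it, and nonempty, since \<open>p\<close> is not constant; the latter makes \<open>r\<close> positive.
\<close>

lemma spec_radius_less_annihilating_poly:
  fixes A :: "real^'n^'n"
  assumes r: "spec_radius A < r"
  obtains p where "p \<noteq> 0" "mpoly (cmat A) p = 0" "\<And>l. poly p l = 0 \<Longrightarrow> norm l < r" "0 < r"
proof -
  obtain p where p: "p \<noteq> 0" "mpoly (cmat A) p = 0"
    and roots: "\<And>l. poly p l = 0 \<longleftrightarrow> (\<exists>v. v \<noteq> 0 \<and> cmat A *v v = l *s v)"
    using exists_annihilating_poly_roots_eigenvalues by blast
  have spec: "spec A = {l. poly p l = 0}"
    unfolding spec_def roots ..
  then have "finite (spec A)"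
    using p poly_roots_finite by simp
  then have bound: "norm l < r" if "poly p l = 0" for l
    using r that unfolding spec_radius_def spec by (subst (asm) Max_less_iff) auto
  have "degree p \<noteq> 0"
  proof
    assume "degree p = 0"
    then obtain c where c: "p = [:c:]"
      by (auto elim: degree_eq_zeroE)
    then have "mat c = (0 :: complex^'n^'n)"
      using p by (simp add: mpoly_pCons matrix_mult_zero)
    then have "(mat c :: complex^'n^'n) $ undefined $ undefined = 0"
      by simp
    then have "c = 0"
      by (simp add: mat_def)
    with c p show False
      by simp
  qed
  then obtain l where "poly p l = 0"
    using fundamental_theorem_of_algebra by (auto simp: constant_degree)
  then have "0 < r"
    using bound [of l] norm_ge_zero [of l] by linarith
  with p bound that show thesis
    by blast
qed

lemma matpow_tendsto_0:
  assumes "spec_radius A < r"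
  shows "(\<lambda>j. norm (matpow A j *v x) / r ^ j) \<longlonglongrightarrow> 0"
proof -
  obtain p where p: "p \<noteq> 0" "mpoly (cmat A) p = 0" "\<And>l. poly p l = 0 \<Longrightarrow> norm l < r"
    using spec_radius_less_annihilating_poly [OF assms] by metis
  have "decays (cmat A) r (mpoly (cmat A) p *v cvec x)"
    by (simp add: p(2) decays_def funpow_matrix_0)
  then have "decays (cmat A) r (cvec x)"
    using decays_of_annihilating_poly p by blast
  then show ?thesis
    unfolding decays_def funpow_cmat norm_cvec by (rule summable_LIMSEQ_zero)
qed

text \<open>
  Convergence on the finitely many unit vectors is uniform on the unit ball. The factor \<open>1/2\<close> is an
  arbitrary constant less than one.
\<close>

lemma matpow_eventually_contracts:
  fixes A :: "real^'n^'n"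
  assumes r: "spec_radius A < r"
  obtains k where "k > 0" "\<And>x. norm (matpow A k *v x) \<le> r ^ k / 2 * norm x"
proof -
  have "r > 0"
    using spec_radius_less_annihilating_poly [OF r] by blast
  let ?s = "\<lambda>j. \<Sum>i\<in>UNIV. norm (matpow A j *v axis i 1) / r ^ j"
  have "?s \<longlonglongrightarrow> 0"
    using tendsto_sum [of UNIV, OF matpow_tendsto_0 [OF r]] by simp
  then have "\<forall>\<^sub>F j in sequentially. ?s j < 1 / 2"
    by (rule order_tendstoD) simp
  then have "\<forall>\<^sub>F j in sequentially. ?s j < 1 / 2 \<and> j > 0"
    using eventually_gt_at_top [of 0] by eventually_elim simp
  then obtain k where k: "?s k < 1 / 2" "k > 0"
    by (auto simp: eventually_sequentially)
  have "norm (matpow A k *v x) \<le> r ^ k / 2 * norm x" for x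
  proof -
    have "matpow A k *v x = (\<Sum>i\<in>UNIV. x $ i *\<^sub>R (matpow A k *v axis i 1))"
      by (simp add: matrix_mult_sum [of _ x] matrix_vector_mult_basis scalar_mult_eq_scaleR)
    also have "norm \<dots> \<le> (\<Sum>i\<in>UNIV. norm x * norm (matpow A k *v axis i 1))"
      by (rule sum_norm_le) (simp add: mult_right_mono component_le_norm_cart)
    also have "\<dots> = norm x * (?s k * r ^ k)"
      using \<open>r > 0\<close> by (simp add: sum_distrib_left sum_distrib_right)
    also have "\<dots> \<le> norm x * (1 / 2 * r ^ k)"
      using k \<open>r > 0\<close> by (intro mult_left_mono mult_right_mono) auto
    finally show ?thesis
      by (simp add: mult.commute)
  qed
  with k that show thesis
    by blast
qed


section \<open>Lyapunov matrices\<close>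

lemma transpose_plus: "transpose (M + N) = transpose M + transpose N"
  by (simp add: transpose_def vec_eq_iff)

lemma transpose_diff: "transpose (M - N) = transpose M - transpose N"
  by (simp add: transpose_def vec_eq_iff)

lemma transpose_zero: "transpose 0 = 0"
  by (simp add: transpose_def vec_eq_iff)

lemma inner_transpose_mult: "x \<bullet> (transpose M *v y) = (M *v x) \<bullet> (y :: real^'n)"
  by (metis dot_lmul_matrix inner_commute transpose_matrix_vector)

lemma neg_mult_vector: "(- M) *v x = - (M *v (x :: real^'n))"
  by (simp add: matrix_vector_mult_def vec_eq_iff sum_negf)

lemma mult_neg_vector: "M *v (- x) = - (M *v (x :: real^'n))"
  by (simp add: matrix_vector_mult_def vec_eq_iff sum_negf)

lemma matpow_commute: "matpow A j *v (A *v x) = A *v (matpow A j *v x)"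
  by (induction j) (simp_all flip: matrix_vector_mul_assoc)

lemma pos_def_gram_sum:
  fixes W :: "nat \<Rightarrow> real^'n^'n" and w :: "nat \<Rightarrow> real" and k :: nat
  defines "P \<equiv> \<Sum>j<k. w j *\<^sub>R (transpose (W j) ** W j)"
  shows "x \<bullet> (P *v x) = (\<Sum>j<k. w j * (norm (W j *v x))\<^sup>2)" and "sym_mat P"
proof -
  show "x \<bullet> (P *v x) = (\<Sum>j<k. w j * (norm (W j *v x))\<^sup>2)"
    unfolding P_def
    by (induction k)
       (simp_all add: matrix_vector_mult_add_rdistrib inner_add_right inner_transpose_mult
          power2_norm_eq_inner del: transpose_matrix_vector
          flip: scaleR_matrix_vector_assoc matrix_vector_mul_assoc)
  show "sym_mat P"
    unfolding P_def sym_mat_def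
    by (induction k)
       (simp_all add: transpose_plus transpose_zero transpose_scalar matrix_transpose_mul)
qed

text \<open>
  The truncated Lyapunov series \<open>P = \<Sum>j<k. (A\<^sup>j)\<^sup>T A\<^sup>j / r\<^sup>2\<^sup>j\<close>: the difference telescopes to
  \<open>r\<^sup>2 (\<parallel>A\<^sup>k x\<parallel>\<^sup>2 / r\<^sup>2\<^sup>k - \<parallel>x\<parallel>\<^sup>2)\<close>, which is sufficiently negative once \<open>A\<^sup>k / r\<^sup>k\<close> contracts.
\<close>

lemma lyapunov_matrix:
  fixes A :: "real^'n^'n"
  assumes r: "spec_radius A < r"
  obtains P where "pos_def P" "r > 0"
    "\<And>x. (A *v x) \<bullet> (P *v (A *v x)) - r\<^sup>2 * (x \<bullet> (P *v x)) \<le> - (r\<^sup>2 / 2) * (norm x)\<^sup>2"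
proof -
  have "r > 0"
    using spec_radius_less_annihilating_poly [OF r] by blast
  obtain k where k: "k > 0" "\<And>x. norm (matpow A k *v x) \<le> r ^ k / 2 * norm x"
    using matpow_eventually_contracts [OF r] by blast
  define w where "w j = 1 / r ^ (2 * j)" for j
  define P where "P = (\<Sum>j<k. w j *\<^sub>R (transpose (matpow A j) ** matpow A j))"
  define a where "a x j = w j * (norm (matpow A j *v x))\<^sup>2" for x j
  have form: "x \<bullet> (P *v x) = (\<Sum>j<k. a x j)" for x
    unfolding P_def a_def by (rule pos_def_gram_sum)
  have a_nonneg: "0 \<le> a x j" for x j
    using \<open>r > 0\<close> by (simp add: a_def w_def)
  have "pos_def P"
    unfolding pos_def_def
  proof (intro conjI allI impI)
    show "sym_mat P"
      unfolding P_def by (rule pos_def_gram_sum)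
    fix v :: "real^'n" assume "v \<noteq> 0"
    then have "0 < a v 0"
      by (simp add: a_def w_def)
    also have "\<dots> \<le> (\<Sum>j<k. a v j)"
      using k(1) a_nonneg by (intro member_le_sum) auto
    finally show "0 < v \<bullet> (P *v v)"
      by (simp add: form)
  qed
  moreover have "(A *v x) \<bullet> (P *v (A *v x)) - r\<^sup>2 * (x \<bullet> (P *v x)) \<le> - (r\<^sup>2 / 2) * (norm x)\<^sup>2" for x
  proof -
    have "a (A *v x) j = r\<^sup>2 * a x (Suc j)" for j
      using \<open>r > 0\<close>
      by (simp add: a_def w_def matpow_commute matrix_vector_mul_assoc [symmetric] power2_eq_square)
    then have "(A *v x) \<bullet> (P *v (A *v x)) - r\<^sup>2 * (x \<bullet> (P *v x))
        = r\<^sup>2 * ((\<Sum>j<k. a x (Suc j)) - (\<Sum>j<k. a x j))"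
      by (simp add: form right_diff_distrib flip: sum_distrib_left)
    also have "(\<Sum>j<k. a x (Suc j)) - (\<Sum>j<k. a x j) = a x k - a x 0"
      by (simp add: sum_lessThan_telescope flip: sum_subtractf)
    also have "a x k \<le> 1 / 2 * (norm x)\<^sup>2"
    proof -
      have "(norm (matpow A k *v x))\<^sup>2 \<le> (r ^ k / 2 * norm x)\<^sup>2"
        using k(2) by (rule power_mono) simp
      also have "\<dots> = r ^ (2 * k) * (1 / 4 * (norm x)\<^sup>2)"
        by (simp add: power_mult_distrib power_divide power_even_eq)
      finally have "a x k \<le> 1 / 4 * (norm x)\<^sup>2"
        using \<open>r > 0\<close> by (simp add: a_def w_def pos_divide_le_eq mult.commute)
      also have "\<dots> \<le> 1 / 2 * (norm x)\<^sup>2"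
        by simp
      finally show ?thesis .
    qed
    finally show ?thesis
      using \<open>r > 0\<close> by (simp add: a_def w_def algebra_simps)
  qed
  ultimately show thesis
    using that \<open>r > 0\<close> by blast
qed


section \<open>The quadratic form of the matrix inequality\<close>

definition vjoin :: "'a^'p \<Rightarrow> 'a^'q \<Rightarrow> 'a^('p + 'q)" where
  "vjoin x y = (\<chi> i. case i of Inl k \<Rightarrow> x $ k | Inr k \<Rightarrow> y $ k)"

lemma vjoin_cases:
  fixes z :: "'a^('p::finite + 'q::finite)"
  obtains x y where "z = vjoin x y"
proof
  show "z = vjoin (\<chi> i. z $ Inl i) (\<chi> i. z $ Inr i)"
    by (simp add: vjoin_def vec_eq_iff split: sum.split)
qed

lemma vjoin_nth [simp]: "vjoin x y $ Inl i = x $ i" "vjoin x y $ Inr j = y $ j"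
  by (simp_all add: vjoin_def)

lemma vjoin_eq_0_iff: "vjoin x y = 0 \<longleftrightarrow> x = 0 \<and> y = 0"
  by (auto simp: vec_eq_iff vjoin_def split: sum.split)

lemma sum_UNIV_sum:
  fixes f :: "'p::finite + 'q::finite \<Rightarrow> 'a::comm_monoid_add"
  shows "(\<Sum>z\<in>UNIV. f z) = (\<Sum>x\<in>UNIV. f (Inl x)) + (\<Sum>y\<in>UNIV. f (Inr y))"
  by (simp add: sum.Plus flip: UNIV_Plus_UNIV)

lemma vjoin_inner: "vjoin a b \<bullet> vjoin c d = a \<bullet> c + b \<bullet> d"
  by (simp add: inner_vec_def sum_UNIV_sum)

lemma vcat_mult: "vcat M N *v z = vjoin (M *v z) (N *v z)"
  by (simp add: vec_eq_iff matrix_vector_mult_def vcat_def vjoin_def split: sum.split)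

lemma hcat_mult: "hcat M N *v vjoin x y = M *v x + N *v y"
  by (simp add: vec_eq_iff matrix_vector_mult_def hcat_def sum_UNIV_sum)

lemma transpose_block:
  "transpose (vcat (hcat a b) (hcat c d))
    = vcat (hcat (transpose a) (transpose c)) (hcat (transpose b) (transpose d))"
  by (simp add: vec_eq_iff transpose_def vcat_def hcat_def split: sum.split)

lemma lmi_quadratic_form:
  fixes A :: "real^'n^'n" and B :: "real^'m^'n"
    and U :: "real^('h::{finite,linorder} \<times> 'm)"
  shows "vjoin x U \<bullet> (lmi_matrix A B Abar Bbar C D \<eta> P \<gamma> *v vjoin x U)
    = (A *v x + B *v (Pi1 *v U)) \<bullet> (P *v (A *v x + B *v (Pi1 *v U))) - \<eta>\<^sup>2 * (x \<bullet> (P *v x))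
      + (norm (Abar *v x + Bbar *v U))\<^sup>2 + (norm U)\<^sup>2 - \<gamma> * (norm (C *v x + D *v U))\<^sup>2"
  unfolding lmi_matrix_def Let_def
  by (simp only: matrix_vector_mult_add_rdistrib matrix_vector_mult_diff_rdistrib
      vcat_mult hcat_mult vjoin_inner inner_add_right inner_diff_right inner_transpose_mult
      matrix_vector_mul_lid matrix_vector_mult_0 add_0 add_0_right scaleR_matrix_vector_assoc [symmetric]
      inner_scaleR_right matrix_vector_right_distrib neg_mult_vector matrix_vector_mul_assoc [symmetric]
      inner_add_left inner_minus_left inner_minus_right dot_square_norm [symmetric] scaleR_minus_left
      power2_norm_eq_inner)
    (simp add: algebra_simps)

lemma sym_lmi_matrix:
  assumes "sym_mat P"
  shows "sym_mat (lmi_matrix A B Abar Bbar C D \<eta> P \<gamma>)"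
  using assms unfolding lmi_matrix_def Let_def sym_mat_def
  by (simp only: transpose_plus transpose_diff transpose_block transpose_zero transpose_scalar
      matrix_transpose_mul transpose_transpose transpose_mat matrix_mul_assoc)


section \<open>Feasibility of the matrix inequality\<close>

text \<open>
  Finsler's lemma. On the unit sphere the inequality with constant \<open>n\<close> holds on an open set
  that grows with \<open>n\<close>; these sets cover the sphere, so finitely many do. Homogeneity extends the
  inequality to all nonzero vectors.
\<close>

lemma finsler:
  fixes M :: "real^'n^'n" and E :: "real^'n^'k"
  assumes neg: "\<And>z. z \<noteq> 0 \<Longrightarrow> E *v z = 0 \<Longrightarrow> z \<bullet> (M *v z) < 0"
  obtains \<gamma> where "\<gamma> > 0" "\<And>z. z \<noteq> 0 \<Longrightarrow> z \<bullet> (M *v z) < \<gamma> * (norm (E *v z))\<^sup>2"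
proof -
  let ?U = "\<lambda>n. {z. z \<bullet> (M *v z) < real n * (norm (E *v z))\<^sup>2}"
  have opn: "open (?U n)" for n
    by (intro open_Collect_less continuous_intros)
  have cover: "sphere 0 1 \<subseteq> (\<Union>n\<in>UNIV. ?U n)"
  proof
    fix z :: "real^'n" assume "z \<in> sphere 0 1"
    then have "z \<noteq> 0"
      by auto
    show "z \<in> (\<Union>n\<in>UNIV. ?U n)"
    proof (cases "E *v z = 0")
      case True
      then show ?thesis
        using neg [OF \<open>z \<noteq> 0\<close>] by simp
    next
      case False
      obtain n where "z \<bullet> (M *v z) / (norm (E *v z))\<^sup>2 < real n"
        using reals_Archimedean2 by blast
      with False have "z \<in> ?U n"
        by (simp add: pos_divide_less_eq)
      then show ?thesis
        by blast
    qed
  qed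
  obtain N where N: "finite N" "sphere 0 1 \<subseteq> (\<Union>n\<in>N. ?U n)"
    by (rule compactE_image [OF compact_sphere opn cover])
  define \<gamma> where "\<gamma> = 1 + (\<Sum>n\<in>N. real n)"
  have "\<gamma> > 0"
    unfolding \<gamma>_def by (simp add: sum_nonneg add_pos_nonneg)
  moreover have "z \<bullet> (M *v z) < \<gamma> * (norm (E *v z))\<^sup>2" if "z \<noteq> 0" for z
  proof -
    define u where "u = inverse (norm z) *\<^sub>R z"
    have "norm u = 1"
      using that by (simp add: u_def)
    then have "u \<in> (\<Union>n\<in>N. ?U n)"
      using N(2) by (simp add: subset_iff)
    then obtain n where n: "n \<in> N" "u \<bullet> (M *v u) < real n * (norm (E *v u))\<^sup>2"
      by blast
    have "real n \<le> (\<Sum>n\<in>N. real n)"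
      using n(1) N(1) by (intro member_le_sum) simp_all
    then have "real n * (norm (E *v u))\<^sup>2 \<le> \<gamma> * (norm (E *v u))\<^sup>2"
      by (intro mult_right_mono) (simp_all add: \<gamma>_def)
    with n(2) have "u \<bullet> (M *v u) < \<gamma> * (norm (E *v u))\<^sup>2"
      by linarith
    moreover have "u \<bullet> (M *v u) = (z \<bullet> (M *v z)) / (norm z)\<^sup>2"
      and "(norm (E *v u))\<^sup>2 = (norm (E *v z))\<^sup>2 / (norm z)\<^sup>2"
      by (simp_all add: u_def matrix_vector_mult_scaleR power2_eq_square divide_inverse)
    ultimately show ?thesis
      using that by (simp add: divide_less_cancel)
  qed
  ultimately show thesis
    using that by blast
qed

text \<open>
  On the kernel of \<open>(C D)\<close> the control is the feedback \<open>U = K x\<close> with \<open>K = - D\<^sup>-\<^sup>1 C\<close>, and the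
  successor is \<open>A_nom x\<close>. The Lyapunov matrix of \<open>A_nom\<close>, scaled by \<open>s\<close>, outweighs the two
  terms \<open>\<parallel>(\<^bold>A + \<^bold>B K) x\<parallel>\<^sup>2 + \<parallel>K x\<parallel>\<^sup>2\<close>; Finsler's lemma then supplies \<open>\<gamma>\<close>.
\<close>

lemma lmi_feasible:
  fixes A :: "real^'n^'n" and B :: "real^'m^'n"
    and Abar :: "real^'n^('h::{finite,linorder} \<times> 'n)" and Bbar :: "real^('h \<times> 'm)^('h \<times> 'n)"
    and C :: "real^'n^('h \<times> 'm)" and D E :: "real^('h \<times> 'm)^('h \<times> 'm)"
  assumes E: "E ** D = mat 1"
    and \<eta>: "spec_radius (A - B ** Pi1 ** E ** C) < \<eta>"
  obtains P \<gamma> where "pos_def P" "\<gamma> > 0" "neg_def (lmi_matrix A B Abar Bbar C D \<eta> P \<gamma>)"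
proof -
  let ?N = "A - B ** Pi1 ** E ** C"
  obtain P0 where P0: "pos_def P0" and "\<eta> > 0"
    and lyap: "\<And>x. (?N *v x) \<bullet> (P0 *v (?N *v x)) - \<eta>\<^sup>2 * (x \<bullet> (P0 *v x)) \<le> - (\<eta>\<^sup>2 / 2) * (norm x)\<^sup>2"
    using lyapunov_matrix [OF \<eta>] by blast
  define K where "K = - (E ** C)"
  have K: "(Abar + Bbar ** K) *v x = Abar *v x + Bbar *v (K *v x)" for x
    by (simp add: matrix_vector_mult_add_rdistrib matrix_vector_mul_assoc)
  obtain b1 where b1: "\<And>x. norm ((Abar + Bbar ** K) *v x) \<le> norm x * b1"
    using bounded_linear.bounded [of "(*v) (Abar + Bbar ** K)"] by auto
  obtain b2 where b2: "\<And>x. norm (K *v x) \<le> norm x * b2"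
    using bounded_linear.bounded [of "(*v) K"] by auto
  (* chosen so that s * eta^2 / 2 exceeds the bound b1^2 + b2^2 on the feedback terms by one *)
  define s where "s = 2 * (b1\<^sup>2 + b2\<^sup>2 + 1) / \<eta>\<^sup>2"
  have "s > 0"
    unfolding s_def using \<open>\<eta> > 0\<close> by (intro divide_pos_pos) (simp_all add: add_nonneg_pos)
  define P where "P = s *\<^sub>R P0"
  have form_P: "x \<bullet> (P *v y) = s * (x \<bullet> (P0 *v y))" for x y
    by (simp add: P_def flip: scaleR_matrix_vector_assoc)
  have P: "pos_def P"
    using P0 \<open>s > 0\<close> form_P by (auto simp: pos_def_def sym_mat_def P_def transpose_scalar)
  let ?L = "\<lambda>\<gamma>. lmi_matrix A B Abar Bbar C D \<eta> P \<gamma>"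
  \<comment> \<open>The value \<open>\<gamma> = 0\<close> leaves exactly the terms that the multiple of \<open>\<parallel>C x + D U\<parallel>\<^sup>2\<close> must offset.\<close>
  have on_kernel: "z \<bullet> (?L 0 *v z) < 0" if "z \<noteq> 0" and ker: "hcat C D *v z = 0" for z
  proof -
    obtain x U where z: "z = vjoin x U"
      by (rule vjoin_cases)
    have "D *v U = - (C *v x)"
      using ker by (simp add: z hcat_mult eq_neg_iff_add_eq_0 add.commute)
    then have "E *v (D *v U) = - (E *v (C *v x))"
      by (simp add: mult_neg_vector)
    then have U: "U = K *v x"
      by (simp add: K_def neg_mult_vector E matrix_vector_mul_assoc)
    have "x \<noteq> 0"
      using that(1) by (auto simp: z U vjoin_eq_0_iff)
    have closed_loop: "A *v x + B *v (Pi1 *v U) = ?N *v x"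
      by (simp add: U K_def neg_mult_vector matrix_vector_mult_diff_rdistrib
          mult_neg_vector flip: matrix_vector_mul_assoc)
    have "(norm (Abar *v x + Bbar *v U))\<^sup>2 \<le> (norm x * b1)\<^sup>2" "(norm U)\<^sup>2 \<le> (norm x * b2)\<^sup>2"
      unfolding U K [symmetric] by (intro power_mono b1 b2 norm_ge_zero)+
    moreover have "s * ((?N *v x) \<bullet> (P0 *v (?N *v x)) - \<eta>\<^sup>2 * (x \<bullet> (P0 *v x)))
        \<le> s * (- (\<eta>\<^sup>2 / 2) * (norm x)\<^sup>2)"
      using lyap \<open>s > 0\<close> by (intro mult_left_mono) simp_all
    moreover have "s * (- (\<eta>\<^sup>2 / 2) * (norm x)\<^sup>2) = - ((norm x * b1)\<^sup>2 + (norm x * b2)\<^sup>2 + (norm x)\<^sup>2)"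
      using \<open>\<eta> > 0\<close> by (simp add: s_def field_simps)
    moreover have "0 < (norm x)\<^sup>2"
      using \<open>x \<noteq> 0\<close> by simp
    ultimately show ?thesis
      unfolding z lmi_quadratic_form closed_loop form_P right_diff_distrib mult.left_commute [of "\<eta>\<^sup>2" s]
      by linarith
  qed
  obtain \<gamma> where \<gamma>: "\<gamma> > 0" "\<And>z. z \<noteq> 0 \<Longrightarrow> z \<bullet> (?L 0 *v z) < \<gamma> * (norm (hcat C D *v z))\<^sup>2"
    using finsler [OF on_kernel] by blast
  have "z \<bullet> (?L \<gamma> *v z) = z \<bullet> (?L 0 *v z) - \<gamma> * (norm (hcat C D *v z))\<^sup>2" for z
    by (rule vjoin_cases [of z]) (simp add: lmi_quadratic_form hcat_mult)
  then have "neg_def (?L \<gamma>)"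
    using P \<gamma>(2) by (simp add: neg_def_def pos_def_def sym_lmi_matrix)
  with P \<gamma>(1) that show thesis
    by blast
qed


section \<open>The condensed optimal control problem\<close>

lemma idx_strict_mono: "h < k \<Longrightarrow> idx h < idx k"
  unfolding idx_def by (intro psubset_card_mono) auto

lemma idx_le_iff: "idx h \<le> idx k \<longleftrightarrow> h \<le> k"
  by (metis idx_strict_mono linorder_not_less order_le_less)

lemma idx_ge_1: "1 \<le> idx h"
proof -
  have "card {h} \<le> card {..h}"
    by (intro card_mono) auto
  then show ?thesis
    by (simp add: idx_def)
qed

lemma bij_betw_idx: "bij_betw (idx :: 'h::{finite,linorder} \<Rightarrow> nat) UNIV {1..CARD('h)}"
proof -
  have inj: "inj (idx :: 'h \<Rightarrow> nat)"
    by (rule linorder_injI) (auto dest: idx_strict_mono)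
  have "range (idx :: 'h \<Rightarrow> nat) \<subseteq> {1..CARD('h)}"
    using idx_ge_1 by (auto simp: idx_def card_mono)
  then have "range (idx :: 'h \<Rightarrow> nat) = {1..CARD('h)}"
    by (rule card_subset_eq [rotated]) (simp_all add: card_image inj)
  with inj show ?thesis
    by (simp add: bij_betw_def)
qed

lemma sum_idx: "(\<Sum>h\<in>(UNIV :: 'h::{finite,linorder} set). f (idx h)) = (\<Sum>k=1..CARD('h). f k)"
  using bij_betw_idx by (rule sum.reindex_bij_betw)

text \<open>
  Variation of constants, indexed by horizon elements instead of numbers so that it matches the
  rows of \<open>stack_B\<close>. The bound on \<open>k\<close> keeps \<open>inv idx\<close> inside the range of \<open>idx\<close>.
\<close>

lemma state_explicit:
  fixes U :: "real^('h::{finite,linorder} \<times> 'm::finite)"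
  assumes "k \<le> CARD('h)"
  shows "state A B x U k
    = matpow A k *v x + (\<Sum>h | idx h \<le> k. matpow A (k - idx h) *v (B *v block U h))"
  using assms
proof (induction k)
  case 0
  have "{h :: 'h. idx h \<le> 0} = {}"
    using idx_ge_1 by (auto simp: not_le less_eq_Suc_le)
  then show ?case
    by (simp only: state.simps matpow.simps sum.empty matrix_vector_mul_lid add_0_right)
next
  case (Suc k)
  define h0 :: 'h where "h0 = inv idx (Suc k)"
  have "range (idx :: 'h \<Rightarrow> nat) = {1..CARD('h)}"
    using bij_betw_idx by (rule bij_betw_imp_surj_on)
  then have "Suc k \<in> range (idx :: 'h \<Rightarrow> nat)"
    using Suc.prems by simp
  then have h0: "idx h0 = Suc k"
    unfolding h0_def by (rule f_inv_into_f)
  have inj: "inj (idx :: 'h \<Rightarrow> nat)"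
    using bij_betw_idx bij_betw_imp_inj_on by blast
  have "idx h \<le> Suc k \<longleftrightarrow> h = h0 \<or> idx h \<le> k" for h :: 'h
    unfolding le_Suc_eq inj_eq [OF inj, of h h0, symmetric] h0 by blast
  then have set: "{h. idx h \<le> Suc k} = insert h0 {h. idx h \<le> k}"
    by auto
  have "A *v (matpow A (k - idx h) *v w) = matpow A (Suc k - idx h) *v w" if "idx h \<le> k" for h :: 'h and w
    using that by (simp add: Suc_diff_le matrix_vector_mul_assoc)
  then have sums: "(\<Sum>h | idx h \<le> k. A *v (matpow A (k - idx h) *v (B *v block U h)))
      = (\<Sum>h | idx h \<le> k. matpow A (Suc k - idx h) *v (B *v block U h))"
    by (intro sum.cong) simp_all
  have "state A B x U (Suc k) = matpow A (Suc k) *v x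
      + ((\<Sum>h | idx h \<le> k. matpow A (Suc k - idx h) *v (B *v block U h)) + B *v block U h0)"
    unfolding state.simps Suc.IH [OF Suc_leD [OF Suc.prems]] matrix_vector_right_distrib
      linear_sum [OF matrix_vector_mul_linear] sums h0_def
    by (simp add: matrix_vector_mul_assoc add.assoc)
  then show ?case
    unfolding set by (subst sum.insert) (simp_all add: h0)
qed

lemma sum_UNIV_prod: "(\<Sum>p\<in>UNIV. f p) = (\<Sum>a\<in>UNIV. \<Sum>b\<in>UNIV. f (a, b))"
  by (simp add: sum.cartesian_product flip: UNIV_Times_UNIV)

lemma state_stack_affine:
  fixes B :: "real^'m^'n" and U :: "real^('h::{finite,linorder} \<times> 'm)"
  shows "state_stack A B x U = stack_A A *v x + stack_B A B *v U"
proof (subst vec_eq_iff, clarify)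
  fix h :: 'h and i :: 'n
  let ?M = "\<lambda>k. matpow A (idx h - idx k)"
  have "(stack_B A B *v U) $ (h, i)
      = (\<Sum>k\<in>UNIV. \<Sum>j\<in>UNIV. (if k \<le> h then (?M k ** B) $ i $ j else 0) * U $ (k, j))"
    by (simp add: matrix_vector_mult_def sum_UNIV_prod stack_B_def)
  also have "\<dots> = (\<Sum>k\<in>UNIV. if k \<le> h then (?M k *v (B *v block U k)) $ i else 0)"
    by (intro sum.cong refl) (simp add: matrix_vector_mul_assoc, simp add: matrix_vector_mult_def block_def)
  also have "\<dots> = (\<Sum>k | idx k \<le> idx h. ?M k *v (B *v block U k)) $ i"
    by (simp add: idx_le_iff sum.If_cases)
  moreover have "idx h \<le> CARD('h)"
    unfolding idx_def by (intro card_mono) auto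
  ultimately show "state_stack A B x U $ (h, i) = (stack_A A *v x + stack_B A B *v U) $ (h, i)"
    by (simp add: state_stack_def state_explicit) (simp add: stack_A_def matrix_vector_mult_def)
qed

lemma inner_blocks: "U \<bullet> W = (\<Sum>h\<in>UNIV. block U h \<bullet> block W h)"
  by (simp add: inner_vec_def sum_UNIV_prod block_def)

lemma sum_if_const: "(\<Sum>b\<in>S. if P then f b else 0) = (if P then \<Sum>b\<in>S. f b else 0)"
  by simp

lemma block_stack_Q:
  "block (stack_Q Q Qf *v X) (h :: 'h::{finite,linorder})
    = (if idx h = CARD('h) then Qf else Q) *v block X h"
  by (simp add: vec_eq_iff block_def matrix_vector_mult_def sum_UNIV_prod stack_Q_def
      if_distrib [where f = "\<lambda>a. a * _"] sum_if_const cong: if_cong)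

lemma block_stack_R: "block (stack_R R *v U) h = R *v block U h"
  by (simp add: vec_eq_iff block_def matrix_vector_mult_def sum_UNIV_prod stack_R_def
      if_distrib [where f = "\<lambda>a. a * _"] sum_if_const cong: if_cong)

lemma sym_stack_Q: "sym_mat Q \<Longrightarrow> sym_mat Qf \<Longrightarrow> sym_mat (stack_Q Q Qf)"
  unfolding sym_mat_def vec_eq_iff by (auto simp: transpose_def stack_Q_def)

text \<open>
  The running cost weighs \<open>x\<^sub>1, \<dots>, x\<^sub>H\<close> and the stacked form \<open>x\<^sub>2, \<dots>, x\<^sub>H\<^sub>+\<^sub>1\<close>; they differ by
  the weight of the initial state, which does not depend on the input.
\<close>

lemma state_cost_stacked:
  fixes A :: "real^'n^'n" and B :: "real^'m^'n" and x :: "real^'n"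
    and U :: "real^('h::{finite,linorder} \<times> 'm)"
  defines "X \<equiv> state_stack A B x U"
  shows "(\<Sum>h\<in>(UNIV::'h set). sqnorm Q (state A B x U (idx h - 1))) + sqnorm Qf (state A B x U CARD('h))
    = sqnorm Q x + X \<bullet> (stack_Q Q Qf *v X)"
proof -
  obtain n where n: "CARD('h) = Suc n"
    using not0_implies_Suc [OF zero_less_card_finite [THEN less_imp_neq, symmetric]] by blast
  let ?s = "state A B x U"
  have block: "block X h = ?s (idx h)" for h
    by (simp add: X_def block_def state_stack_def vec_eq_iff)
  have "X \<bullet> (stack_Q Q Qf *v X) = (\<Sum>h\<in>(UNIV::'h set). sqnorm (if idx h = Suc n then Qf else Q) (?s (idx h)))"
    by (simp only: inner_blocks block_stack_Q block sqnorm_def n)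
  also have "\<dots> = (\<Sum>k=1..Suc n. sqnorm (if k = Suc n then Qf else Q) (?s k))"
    using sum_idx [where f = "\<lambda>k. sqnorm (if k = Suc n then Qf else Q) (?s k)" and 'h = 'h] n by simp
  also have "\<dots> = (\<Sum>k=1..n. sqnorm Q (?s k)) + sqnorm Qf (?s (Suc n))"
    by simp
  moreover have "(\<Sum>h\<in>(UNIV::'h set). sqnorm Q (?s (idx h - 1))) = (\<Sum>k=1..Suc n. sqnorm Q (?s (k - 1)))"
    using sum_idx [where f = "\<lambda>k. sqnorm Q (?s (k - 1))" and 'h = 'h] n by simp
  moreover have "\<dots> = (\<Sum>k=0..n. sqnorm Q (?s k))"
    using sum.shift_bounds_cl_Suc_ivl [of "\<lambda>k. sqnorm Q (?s (k - 1))" 0 n] by simp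
  moreover have "\<dots> = sqnorm Q x + (\<Sum>k=1..n. sqnorm Q (?s k))"
    by (simp add: sum.atLeast_Suc_atMost)
  ultimately show ?thesis
    by (simp add: n)
qed

text \<open>
  Symmetry of the state weights merges the two cross terms of the expanded square into
  \<open>U\<^sup>T C x\<close>.
\<close>

lemma ocp_cost_condensed:
  fixes B :: "real^'m^'n" and x :: "real^'n" and U :: "real^('h::{finite,linorder} \<times> 'm)"
  assumes "sym_mat Q" "sym_mat Qf"
  shows "ocp_cost A B Q Qf R V x t U
    = 1/2 * (sqnorm Q x + sqnorm (stack_Q Q Qf) (stack_A A *v x :: real^('h \<times> 'n)))
      + (U \<bullet> (C_mat A B Q Qf *v x) + 1/2 * (U \<bullet> (D_mat A B Q Qf R *v U)))
      + V (stack_A A *v x + stack_B A B *v U) U t"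
proof -
  let ?a = "stack_A A *v x :: real^('h \<times> 'n)"
  let ?b = "stack_B A B *v U"
  let ?Q = "stack_Q Q Qf :: real^('h \<times> 'n)^('h \<times> 'n)"
  have "transpose ?Q = ?Q"
    using sym_stack_Q [OF assms] by (simp add: sym_mat_def)
  then have cross: "?a \<bullet> (?Q *v ?b) = ?b \<bullet> (?Q *v ?a)"
    using inner_transpose_mult [of ?a ?Q ?b] by (metis inner_commute)
  have C: "U \<bullet> (C_mat A B Q Qf *v x) = ?b \<bullet> (?Q *v ?a)"
    unfolding C_mat_def by (simp only: matrix_vector_mul_assoc [symmetric] inner_transpose_mult)
  have D: "U \<bullet> (D_mat A B Q Qf R *v U) = (\<Sum>h\<in>UNIV. sqnorm R (block U h)) + ?b \<bullet> (?Q *v ?b)"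
    unfolding D_mat_def
    by (simp only: matrix_vector_mul_assoc [symmetric] inner_transpose_mult inner_add_right
        matrix_vector_mult_add_rdistrib sqnorm_def inner_blocks [of U] block_stack_R)
  have "ocp_cost A B Q Qf R V x t U = 1/2 * ((\<Sum>h\<in>UNIV. sqnorm R (block U h))
      + (sqnorm Q x + sqnorm ?Q (?a + ?b))) + V (?a + ?b) U t"
    using state_cost_stacked [of Q A B x U Qf, unfolded state_stack_affine, symmetric]
    unfolding ocp_cost_def sum.distrib state_stack_affine sqnorm_def [of ?Q] by argo
  then show ?thesis
    unfolding C D sqnorm_def [of ?Q]
    by (simp add: matrix_vector_right_distrib inner_add_left inner_add_right cross field_simps)
qed


section \<open>Gradient of the cost\<close>

lemma GDERIV_exists:
  fixes f :: "'a::euclidean_space \<Rightarrow> real"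
  assumes "(f has_derivative f') (at z)"
  obtains g where "GDERIV f z :> g" "f' = (\<lambda>h. h \<bullet> g)"
proof -
  have "f' h = h \<bullet> adjoint f' 1" for h
    using adjoint_works [OF has_derivative_linear [OF assms], of h 1] by simp
  then have "f' = (\<lambda>h. h \<bullet> adjoint f' 1)"
    by (rule ext)
  with assms show thesis
    by (intro that) (simp_all add: gderiv_def)
qed

lemma grad_eq:
  assumes "GDERIV f z :> g"
  shows "grad f z = g"
  unfolding grad_def
proof (rule the_equality)
  fix g' assume "GDERIV f z :> g'"
  then have "(\<lambda>h. h \<bullet> g') = (\<lambda>h. h \<bullet> g)"
    using assms unfolding gderiv_def by (rule has_derivative_unique)
  then have "\<forall>h. h \<bullet> g' = h \<bullet> g"
    by (simp add: fun_eq_iff)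
  then show "g' = g"
    by (simp only: vector_eq_ldot)
qed (fact assms)

text \<open>
  Chain rule for the total derivative: \<open>psi\<close> is built from partial gradients, but is the gradient
  along the affine map that replaces \<open>X\<close> by its prediction.
\<close>

lemma GDERIV_psi:
  fixes A :: "real^'n^'n" and B :: "real^'m^'n"
    and V :: "real^('h::{finite,linorder} \<times> 'n) \<Rightarrow> real^('h \<times> 'm) \<Rightarrow> nat \<Rightarrow> real"
  assumes diff: "(\<lambda>(X, U). V X U t) differentiable_on UNIV"
  shows "GDERIV (\<lambda>U. V (a + stack_B A B *v U) U t) U :> psi A B V t (a + stack_B A B *v U) U"
proof -
  let ?Bb = "stack_B A B :: real^('h \<times> 'm)^('h \<times> 'n)"
  define X where "X = a + ?Bb *v U"
  obtain F where F: "((\<lambda>(X, U). V X U t) has_derivative F) (at (X, U))"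
    using diff unfolding differentiable_on_def differentiable_def by auto
  then obtain g where g: "F = (\<lambda>h. h \<bullet> g)"
    using GDERIV_exists by blast
  have chain: "((\<lambda>s. V (p s) (q s) t) has_derivative (\<lambda>h. F (p' h, q' h))) (at s0)"
    if "(p has_derivative p') (at s0)" "(q has_derivative q') (at s0)" "p s0 = X" "q s0 = U"
    for p p' q q' and s0 :: "'s::real_normed_vector"
    using has_derivative_compose [OF has_derivative_Pair [OF that(1,2)], of "\<lambda>(X, U). V X U t" F] F that(3,4)
    by simp
  have "GDERIV (\<lambda>X'. V X' U t) X :> fst g"
    using chain [OF has_derivative_ident has_derivative_const [of U]]
    by (simp add: gderiv_def g inner_prod_def)
  moreover have "GDERIV (\<lambda>U'. V X U' t) U :> snd g"
    using chain [OF has_derivative_const [of X] has_derivative_ident]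
    by (simp add: gderiv_def g inner_prod_def)
  ultimately have psi: "psi A B V t X U = snd g + transpose ?Bb *v fst g"
    unfolding psi_def by (simp only: grad_eq)
  have "((\<lambda>U. a + ?Bb *v U) has_derivative (\<lambda>h. ?Bb *v h)) (at U)"
    by (auto intro!: derivative_eq_intros bounded_linear_imp_has_derivative)
  then have "((\<lambda>U. V (a + ?Bb *v U) U t) has_derivative (\<lambda>h. F (?Bb *v h, h))) (at U)"
    by (rule chain) (auto simp: X_def)
  then show ?thesis
    unfolding gderiv_def X_def [symmetric] psi inner_add_right inner_transpose_mult
    by (simp add: g inner_prod_def add.commute)
qed

lemma GDERIV_quadratic:
  fixes D :: "real^'n^'n"
  assumes "sym_mat D"
  shows "GDERIV (\<lambda>U. U \<bullet> c + 1/2 * (U \<bullet> (D *v U))) U :> c + D *v U"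
proof -
  have sym: "x \<bullet> (D *v y) = y \<bullet> (D *v x)" for x y
    using inner_transpose_mult [of x D y] assms by (simp only: sym_mat_def inner_commute)
  have D: "((*v) D has_derivative (*v) D) (at U)"
    by (simp add: bounded_linear_imp_has_derivative)
  show ?thesis
    unfolding gderiv_def
    by (rule derivative_eq_intros refl D)+ (auto simp: sym [of U] inner_add_right)
qed

lemma GDERIV_ocp_cost:
  fixes A Q Qf :: "real^'n^'n" and B :: "real^'m^'n" and R :: "real^'m^'m"
    and V :: "real^('h::{finite,linorder} \<times> 'n) \<Rightarrow> real^('h \<times> 'm) \<Rightarrow> nat \<Rightarrow> real"
  assumes "sym_mat Q" "sym_mat Qf" "sym_mat (D_mat A B Q Qf R :: real^('h \<times> 'm)^('h \<times> 'm))"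
    and "(\<lambda>(X, U). V X U t) differentiable_on UNIV"
  shows "GDERIV (ocp_cost A B Q Qf R V x t) U
    :> C_mat A B Q Qf *v x + D_mat A B Q Qf R *v U + psi A B V t (stack_A A *v x + stack_B A B *v U) U"
  unfolding ocp_cost_condensed [OF assms(1,2), abs_def] gderiv_def
  by (rule has_derivative_eq_rhs [OF has_derivative_add [OF has_derivative_add [OF has_derivative_const
            GDERIV_quadratic [OF assms(3), unfolded gderiv_def]]
          GDERIV_psi [where V = V and t = t, OF assms(4), unfolded gderiv_def]]])
     (simp add: inner_add_right)


section \<open>Stationary points and minimizers\<close>

text \<open>
  By homogeneity the quotient \<open>f / g\<close> is determined on the unit sphere, where it attains its
  maximum; being attained, the maximum is still less than one.
\<close>

lemma homogeneous_strict_bound: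
  fixes f g :: "real^'n \<Rightarrow> real"
  assumes cont: "continuous_on UNIV f" "continuous_on UNIV g"
    and hom: "\<And>c u. f (c *\<^sub>R u) = \<bar>c\<bar> * f u" "\<And>c u. g (c *\<^sub>R u) = \<bar>c\<bar> * g u"
    and less: "\<And>u. u \<noteq> 0 \<Longrightarrow> 0 \<le> f u \<and> f u < g u"
  obtains q where "0 \<le> q" "q < 1" "\<And>u. f u \<le> q * g u"
proof -
  let ?S = "sphere 0 1 :: (real^'n) set"
  have nz: "u \<noteq> 0" if "u \<in> ?S" for u
    using that by auto
  have pos: "0 \<le> f u" "f u < g u" "0 < g u" if "u \<in> ?S" for u
    using less [OF nz [OF that]] by auto
  have "axis undefined 1 \<in> ?S"
    by (simp add: norm_axis_1)
  then have "?S \<noteq> {}"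
    by (rule ex_in_conv [THEN iffD1, OF exI])
  moreover have "continuous_on ?S (\<lambda>u. f u / g u)"
    using cont [THEN continuous_on_subset, OF subset_UNIV] pos(3)
    by (intro continuous_on_divide ballI) (simp_all add: less_imp_neq [symmetric])
  ultimately have "\<exists>u0\<in>?S. \<forall>u\<in>?S. f u / g u \<le> f u0 / g u0"
    by (intro continuous_attains_sup compact_sphere)
  then obtain u0 where u0: "u0 \<in> ?S" "\<And>u. u \<in> ?S \<Longrightarrow> f u / g u \<le> f u0 / g u0"
    by (elim bexE) (simp only: Ball_def)
  define q where "q = f u0 / g u0"
  have "0 \<le> q" "q < 1"
    using pos [OF u0(1)] by (simp_all add: q_def)
  moreover have "f u \<le> q * g u" for u
  proof (cases "u = 0")
    case True
    then show ?thesis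
      using hom [of 0 0] by simp
  next
    case False
    define v where "v = inverse (norm u) *\<^sub>R u"
    have v: "v \<in> ?S"
      using False by (simp add: v_def)
    have "f v \<le> q * g v"
      using u0(2) [OF v] unfolding q_def [symmetric] pos_divide_le_eq [OF pos(3) [OF v]] .
    then have "inverse (norm u) * f u \<le> inverse (norm u) * (q * g u)"
      by (simp add: v_def hom mult.left_commute)
    then show ?thesis
      by (rule mult_left_le_imp_le) (simp add: False)
  qed
  ultimately show thesis
    using that by blast
qed

text \<open>
  At a minimizer \<open>W \<noteq> Us\<close> over the ball around \<open>Us\<close>, a small step along \<open>- D (W - Us)\<close> lowers
  \<open>J\<close> and also stays in the ball, because the distance to \<open>Us\<close> decreases to first order. Taking
  the ball to contain \<open>U\<close> gives a global statement without coercivity of \<open>J\<close>.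
\<close>

lemma minimum_of_descent_field:
  fixes J :: "real^'n \<Rightarrow> real" and G :: "real^'n \<Rightarrow> real^'n" and D :: "real^'n^'n"
  assumes grad: "\<And>U. GDERIV J U :> G U"
    and pos: "\<And>d. d \<noteq> 0 \<Longrightarrow> d \<bullet> (D *v d) > 0"
    and descent: "\<And>U. U \<noteq> Us \<Longrightarrow> G U \<bullet> (D *v (U - Us)) > 0"
  shows "J Us \<le> J U"
proof -
  let ?K = "cball Us (dist Us U)"
  have "continuous_on UNIV J"
    using grad unfolding gderiv_def
    by (intro continuous_at_imp_continuous_on ballI) (auto intro: has_derivative_continuous)
  then have "continuous_on ?K J"
    by (rule continuous_on_subset) simp
  then have "\<exists>W\<in>?K. \<forall>Y\<in>?K. J W \<le> J Y"
    by (intro continuous_attains_inf) simp_all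
  then obtain W where W: "W \<in> ?K" "\<And>Y. Y \<in> ?K \<Longrightarrow> J W \<le> J Y"
    by blast
  have "W = Us"
  proof (rule ccontr)
    assume ne: "W \<noteq> Us"
    define e where "e = D *v (W - Us)"
    have path: "((\<lambda>s. W + s *\<^sub>R (- e)) has_derivative (\<lambda>s. s *\<^sub>R (- e))) (at 0)"
      by (auto intro!: derivative_eq_intros)
    have "((\<lambda>s. J (W + s *\<^sub>R (- e))) has_derivative (\<lambda>s. (s *\<^sub>R (- e)) \<bullet> G W)) (at 0)"
      using has_derivative_compose [OF path, of J "\<lambda>h. h \<bullet> G W"] grad [of W]
      by (simp add: gderiv_def)
    then have "DERIV (\<lambda>s. J (W + s *\<^sub>R (- e))) 0 :> - (G W \<bullet> e)"
      unfolding has_field_derivative_def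
      by (rule has_derivative_eq_rhs) (simp add: fun_eq_iff inner_commute)
    moreover have "- (G W \<bullet> e) < 0"
      using descent [OF ne] by (simp add: e_def)
    ultimately obtain d1
      where d1: "d1 > 0" "\<And>s. 0 < s \<Longrightarrow> s < d1 \<Longrightarrow> J (W + s *\<^sub>R (- e)) < J W"
      by (auto dest!: DERIV_neg_dec_right)
    let ?N = "\<lambda>s. (W + s *\<^sub>R (- e) - Us) \<bullet> (W + s *\<^sub>R (- e) - Us)"
    have "(?N has_derivative (\<lambda>s. 2 * ((W - Us) \<bullet> (s *\<^sub>R (- e))))) (at 0)"
      by (rule derivative_eq_intros refl)+ (simp add: inner_commute)
    then have "DERIV ?N 0 :> - (2 * ((W - Us) \<bullet> e))"
      unfolding has_field_derivative_def
      by (rule has_derivative_eq_rhs) (simp add: fun_eq_iff)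
    moreover have "- (2 * ((W - Us) \<bullet> e)) < 0"
      using pos [of "W - Us"] ne by (simp add: e_def)
    ultimately obtain d2 where d2: "d2 > 0" "\<And>s. 0 < s \<Longrightarrow> s < d2 \<Longrightarrow> ?N s < ?N 0"
      by (drule_tac DERIV_neg_dec_right) auto
    define s where "s = min d1 d2 / 2"
    have s: "0 < s" "s < d1" "s < d2"
      using d1 d2 by (auto simp: s_def)
    have "norm (W + s *\<^sub>R (- e) - Us) < norm (W - Us)"
      using d2(2) [OF s(1,3)] by (simp add: norm_lt)
    then have "W + s *\<^sub>R (- e) \<in> ?K"
      using W(1) by (simp add: dist_norm norm_minus_commute)
    then show False
      using W(2) d1(2) [OF s(1,2)] by fastforce
  qed
  then show ?thesis
    using W(2) [of U] by simp
qed

lemma unique_minimizer_of_descent_field: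
  fixes J :: "real^'n \<Rightarrow> real" and G :: "real^'n \<Rightarrow> real^'n" and D :: "real^'n^'n"
  assumes grad: "\<And>U. GDERIV J U :> G U"
    and pos: "\<And>d. d \<noteq> 0 \<Longrightarrow> d \<bullet> (D *v d) > 0"
    and descent: "\<And>U. U \<noteq> Us \<Longrightarrow> G U \<bullet> (D *v (U - Us)) > 0"
  shows "is_arg_min J (\<lambda>_. True) U \<longleftrightarrow> U = Us"
proof
  assume min: "is_arg_min J (\<lambda>_. True) U"
  then have "\<forall>Y\<in>UNIV. J U \<le> J Y"
    by (auto simp: is_arg_min_linorder)
  then have "(\<lambda>h. h \<bullet> G U) = (\<lambda>_. 0)"
    using differential_zero_maxmin [of U UNIV J] grad [of U] unfolding gderiv_def by blast
  then have "G U = 0"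
    by (metis inner_eq_zero_iff)
  then show "U = Us"
    using descent [of U] by auto
next
  assume "U = Us"
  then show "is_arg_min J (\<lambda>_. True) U"
    using minimum_of_descent_field [OF assms] by (simp add: is_arg_min_linorder)
qed

lemma pos_def_matrix_inv:
  assumes "pos_def D"
  shows "D ** matrix_inv D = mat 1" and "matrix_inv D ** D = mat 1"
proof -
  have "\<forall>v. D *v v = 0 \<longrightarrow> v = 0"
  proof (intro allI impI)
    fix v assume "D *v v = 0"
    then show "v = 0"
      using assms unfolding pos_def_def by (metis inner_zero_right less_irrefl)
  qed
  then have "invertible D"
    unfolding invertible_left_inverse matrix_left_invertible_ker .
  then show "D ** matrix_inv D = mat 1" "matrix_inv D ** D = mat 1"
    unfolding invertible_def matrix_inv_def by (metis (mono_tags, lifting) someI_ex)+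
qed

text \<open>
  Restricting the inequality to \<open>x = 0\<close> and dropping the nonnegative \<open>P\<close>-term leaves
  \<open>\<parallel>\<^bold>B U\<parallel>\<^sup>2 + \<parallel>U\<parallel>\<^sup>2 < \<gamma> \<parallel>D U\<parallel>\<^sup>2\<close>.
\<close>

lemma lmi_small_gain:
  fixes A :: "real^'n^'n" and B :: "real^'m^'n"
    and Abar :: "real^'n^('h::{finite,linorder} \<times> 'n)" and Bbar :: "real^('h \<times> 'm)^('h \<times> 'n)"
  assumes P: "pos_def P" and \<gamma>: "\<gamma> > 0"
    and lmi: "neg_def (lmi_matrix A B Abar Bbar C D \<eta> P \<gamma>)" and "U \<noteq> 0"
  shows "\<gamma> powr (- 1/2) * norm (Bbar *v U, U) < norm (D *v U)"
proof -
  let ?v = "B *v (Pi1 *v U)"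
  have "vjoin 0 U \<bullet> (lmi_matrix A B Abar Bbar C D \<eta> P \<gamma> *v vjoin 0 U) < 0"
    using lmi \<open>U \<noteq> 0\<close> by (simp add: neg_def_def vjoin_eq_0_iff)
  moreover have "?v \<bullet> (P *v ?v) \<ge> 0"
    using P by (cases "?v = 0") (auto simp: pos_def_def less_imp_le)
  ultimately have "(norm (Bbar *v U))\<^sup>2 + (norm U)\<^sup>2 < \<gamma> * (norm (D *v U))\<^sup>2"
    unfolding lmi_quadratic_form by simp
  then have "sqrt ((norm (Bbar *v U))\<^sup>2 + (norm U)\<^sup>2) < sqrt (\<gamma> * (norm (D *v U))\<^sup>2)"
    by (rule real_sqrt_less_mono)
  then have "norm (Bbar *v U, U) < sqrt \<gamma> * norm (D *v U)"
    by (simp add: norm_Pair real_sqrt_mult)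
  moreover have "\<gamma> powr (- 1/2) = 1 / sqrt \<gamma>"
    using \<gamma> by (simp add: powr_minus_divide powr_half_sqrt)
  ultimately show ?thesis
    using \<gamma> by (simp add: pos_divide_less_eq mult.commute)
qed

text \<open>
  The smallness hypothesis says that the regularizer gradient is dominated by \<open>D\<close>. It gives both the
  contraction, hence the stationary point, and the sign of the gradient against \<open>D (U - Us)\<close>,
  hence optimality.
\<close>

lemma unique_ocp_solution:
  fixes A Q Qf :: "real^'n^'n" and B :: "real^'m^'n" and R :: "real^'m^'m"
    and V :: "real^('h::{finite,linorder} \<times> 'n) \<Rightarrow> real^('h \<times> 'm) \<Rightarrow> nat \<Rightarrow> real"
  defines "D \<equiv> D_mat A B Q Qf R :: real^('h \<times> 'm)^('h \<times> 'm)"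
  assumes sym: "sym_mat Q" "sym_mat Qf"
    and posD: "pos_def D"
    and diff: "(\<lambda>(X, U). V X U t) differentiable_on UNIV"
    and lip: "psi_lipschitz L A B V"
    and small: "\<And>U. U \<noteq> 0 \<Longrightarrow> L * norm (stack_B A B *v U, U) < norm (D *v U)"
  shows "\<exists>Us. {U. ocp_solution A B Q Qf R V x t U} = {Us} \<and>
    {U. ocp_stationary A B Q Qf R V x t U} = {Us}"
proof -
  let ?Bb = "stack_B A B :: real^('h \<times> 'm)^('h \<times> 'n)"
  define \<phi> where "\<phi> U = psi A B V t (stack_A A *v x + ?Bb *v U) U" for U
  define G where "G U = C_mat A B Q Qf *v x + D *v U + \<phi> U" for U
  have stationary: "ocp_stationary A B Q Qf R V x t U \<longleftrightarrow> G U = 0" for U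
    by (simp add: ocp_stationary_def G_def \<phi>_def D_def)
  have "L \<ge> 0"
    using lip lipschitz_on_nonneg unfolding psi_lipschitz_def by blast
  have lip_\<phi>: "norm (\<phi> U - \<phi> W) \<le> L * norm (?Bb *v (U - W), U - W)" for U W
    using lip lipschitz_onD [of L UNIV "\<lambda>(X, U). psi A B V t X U"
        "(stack_A A *v x + ?Bb *v U, U)" "(stack_A A *v x + ?Bb *v W, W)"]
    by (simp add: psi_lipschitz_def \<phi>_def dist_norm matrix_vector_mult_diff_distrib)
  obtain q where q: "0 \<le> q" "q < 1" "\<And>U. L * norm (?Bb *v U, U) \<le> q * norm (D *v U)"
  proof (rule homogeneous_strict_bound)
    show "continuous_on UNIV (\<lambda>U. L * norm (?Bb *v U, U))" "continuous_on UNIV (\<lambda>U. norm (D *v U))"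
      by (intro continuous_intros)+
    show "L * norm (?Bb *v (c *\<^sub>R U), c *\<^sub>R U) = \<bar>c\<bar> * (L * norm (?Bb *v U, U))" for c U
      by (simp add: matrix_vector_mult_scaleR flip: scaleR_Pair)
    show "norm (D *v (c *\<^sub>R U)) = \<bar>c\<bar> * norm (D *v U)" for c U
      by (simp add: matrix_vector_mult_scaleR)
    show "0 \<le> L * norm (?Bb *v U, U) \<and> L * norm (?Bb *v U, U) < norm (D *v U)" if "U \<noteq> 0" for U
      using \<open>L \<ge> 0\<close> small [OF that] by simp
  qed blast
  define E where "E = matrix_inv D"
  have E: "D *v (E *v W) = W" for W
    using pos_def_matrix_inv(1) [OF posD] by (simp add: matrix_vector_mul_assoc E_def)
  \<comment> \<open>In \<open>W = D U\<close> the Euclidean norm measures \<open>D U\<close>, the quantity in the small-gain bound.\<close>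
  let ?T = "\<lambda>W. - (C_mat A B Q Qf *v x + \<phi> (E *v W))"
  have "dist (?T W) (?T Y) \<le> q * dist W Y" for W Y
  proof -
    have "dist (?T W) (?T Y) = norm (\<phi> (E *v W) - \<phi> (E *v Y))"
      by (simp add: dist_norm norm_minus_commute)
    also have "\<dots> \<le> q * norm (D *v (E *v W - E *v Y))"
      using lip_\<phi> q(3) order_trans by blast
    finally show ?thesis
      by (simp add: dist_norm matrix_vector_mult_diff_distrib E)
  qed
  then have "\<exists>!W. ?T W = W"
    by (intro banach_fix_type [OF q(1,2)] allI)
  then obtain Ws where Ws: "?T Ws = Ws"
    by blast
  define Us where "Us = E *v Ws"
  have Us: "G Us = 0"
    using arg_cong [OF Ws, of "\<lambda>W. W + C_mat A B Q Qf *v x + \<phi> (E *v Ws)"]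
    by (simp add: G_def Us_def E algebra_simps)
  have descent: "G U \<bullet> (D *v (U - Us)) > 0" if "U \<noteq> Us" for U
  proof -
    let ?d = "D *v (U - Us)" and ?e = "\<phi> U - \<phi> Us"
    have less: "norm ?e < norm ?d"
      using lip_\<phi> [of U Us] small [of "U - Us"] that by simp
    then have "norm ?e * norm ?d < norm ?d * norm ?d"
      using norm_ge_zero [of ?e] by (intro mult_strict_right_mono) linarith+
    moreover have "- (norm ?e * norm ?d) \<le> ?e \<bullet> ?d"
      using Cauchy_Schwarz_ineq2 [of ?e ?d] by linarith
    moreover have "G U = ?d + ?e"
      using Us by (simp add: G_def matrix_vector_mult_diff_distrib algebra_simps add_eq_0_iff2)
    ultimately show ?thesis
      by (simp add: inner_add_left dot_square_norm power2_eq_square)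
  qed
  have grad: "GDERIV (ocp_cost A B Q Qf R V x t) U :> G U" for U
    using GDERIV_ocp_cost [of Q Qf A B R V t x U] sym posD diff
    by (simp add: G_def \<phi>_def D_def pos_def_def)
  have "ocp_solution A B Q Qf R V x t U \<longleftrightarrow> U = Us" for U
    unfolding ocp_solution_def
    by (rule unique_minimizer_of_descent_field [OF grad _ descent])
       (use posD in \<open>simp add: pos_def_def\<close>)
  moreover have "G U = 0 \<longleftrightarrow> U = Us" for U
    using Us descent [of U] by (cases "U = Us") auto
  ultimately show ?thesis
    by (auto simp: stationary)
qed


section \<open>Feasibility and unique optimality for every decay rate\<close>

theorem theorem4:
  fixes A Q Qf :: "real^'n^'n"
    and B :: "real^'m^'n"
    and R :: "real^'m^'m"
    and V :: "real^('h::{finite,linorder} \<times> 'n) \<Rightarrow> real^('h \<times> 'm) \<Rightarrow> nat \<Rightarrow> real"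
    and Abar :: "real^'n^('h \<times> 'n)"
    and Bbar :: "real^('h \<times> 'm)^('h \<times> 'n)"
    and C :: "real^'n^('h \<times> 'm)"
    and D :: "real^('h \<times> 'm)^('h \<times> 'm)"
    and A_nom :: "real^'n^'n"
  assumes Abar: "Abar = stack_A A"
    and Bbar: "Bbar = stack_B A B"
    and C: "C = C_mat A B Q Qf"
    and D: "D = D_mat A B Q Qf R"
    and A_nom: "A_nom = A - B ** Pi1 ** matrix_inv D ** C"
    and symQ: "sym_mat Q"
    and symQf: "sym_mat Qf"
    and symR: "sym_mat R"
    and posD: "pos_def D"
    and diffV: "\<And>t. (\<lambda>(X, U). V X U t) differentiable_on UNIV"
    and lipV: "\<exists>L. psi_lipschitz L A B V"
    and schurA: "schur_stable A_nom"
  shows "\<forall>\<eta>. spec_radius A_nom < \<eta> \<and> \<eta> < 1 \<longrightarrow>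
      (\<exists>P \<gamma>. pos_def P \<and> \<gamma> > 0 \<and> neg_def (lmi_matrix A B Abar Bbar C D \<eta> P \<gamma>)) \<and>
      (\<forall>P \<gamma>. pos_def P \<and> \<gamma> > 0 \<and> neg_def (lmi_matrix A B Abar Bbar C D \<eta> P \<gamma>) \<longrightarrow>
        (\<forall>c > 0. psi_lipschitz (\<gamma> powr (- 1/2)) A B (\<lambda>X U t. c * V X U t) \<longrightarrow>
          (\<forall>x t. \<exists>Us.
            {U. ocp_solution A B Q Qf R (\<lambda>X U t. c * V X U t) x t U} = {Us} \<and>
            {U. ocp_stationary A B Q Qf R (\<lambda>X U t. c * V X U t) x t U} = {Us})))"
proof (intro allI impI)
  fix \<eta>
  assume \<eta>: "spec_radius A_nom < \<eta> \<and> \<eta> < 1"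
  have inv: "matrix_inv D ** D = mat 1"
    using posD by (rule pos_def_matrix_inv)
  have "spec_radius (A - B ** Pi1 ** matrix_inv D ** C) < \<eta>"
    using \<eta> by (simp add: A_nom)
  then have "\<exists>P \<gamma>. pos_def P \<and> \<gamma> > 0 \<and> neg_def (lmi_matrix A B Abar Bbar C D \<eta> P \<gamma>)"
    using lmi_feasible [OF inv] by blast
  moreover have "\<exists>Us. {U. ocp_solution A B Q Qf R (\<lambda>X U t. c * V X U t) x t U} = {Us} \<and>
      {U. ocp_stationary A B Q Qf R (\<lambda>X U t. c * V X U t) x t U} = {Us}"
    if P: "pos_def P" "\<gamma> > 0" "neg_def (lmi_matrix A B Abar Bbar C D \<eta> P \<gamma>)"
      and lip: "psi_lipschitz (\<gamma> powr (- 1/2)) A B (\<lambda>X U t. c * V X U t)"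
    for P \<gamma> c x t
  proof (rule unique_ocp_solution [OF symQ symQf _ _ lip])
    show "pos_def (D_mat A B Q Qf R :: real^('h \<times> 'm)^('h \<times> 'm))"
      using posD by (simp add: D)
    show "(\<lambda>(X, U). c * V X U t) differentiable_on UNIV"
      using diffV [of t] unfolding differentiable_on_def case_prod_beta
      by (intro ballI differentiable_mult differentiable_const) blast
    show "\<gamma> powr (- 1/2) * norm (stack_B A B *v U, U) < norm (D_mat A B Q Qf R *v U)"
      if "U \<noteq> 0" for U :: "real^('h \<times> 'm)"
      using lmi_small_gain [OF P that] by (simp add: Bbar D)
  qed
  ultimately show "(\<exists>P \<gamma>. pos_def P \<and> \<gamma> > 0 \<and> neg_def (lmi_matrix A B Abar Bbar C D \<eta> P \<gamma>)) \<and>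
      (\<forall>P \<gamma>. pos_def P \<and> \<gamma> > 0 \<and> neg_def (lmi_matrix A B Abar Bbar C D \<eta> P \<gamma>) \<longrightarrow>
        (\<forall>c > 0. psi_lipschitz (\<gamma> powr (- 1/2)) A B (\<lambda>X U t. c * V X U t) \<longrightarrow>
          (\<forall>x t. \<exists>Us.
            {U. ocp_solution A B Q Qf R (\<lambda>X U t. c * V X U t) x t U} = {Us} \<and>
            {U. ocp_stationary A B Q Qf R (\<lambda>X U t. c * V X U t) x t U} = {Us})))"
    by blast
qed

end
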